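(* Let $n$ be a positive integer and let $L$ be an $n$-contractive axiomatic extension of $\mathrm{MTL}$. The following are equivalent: (1) $L$ enjoys the single chain completeness; (2) $L$ enjoys the subdirect single chain completeness.
   Context: Monoidal t-norm based logic $\mathrm{MTL}$: formulas are built from a denumerable set of propositional variables with the binary connectives $\&,\land,\to$ and the constant $\bot$. Derived connectives: $\neg\varphi:=\varphi\to\bot$, $\varphi\vee\psi:=((\varphi\to\psi)\to\psi)\land((\psi\to\varphi)\to\varphi)$; $\varphi^n$ is $\varphi\&\cdots\&\varphi$ ($n$ times). Axiom schemata: $(\varphi\to\psi)\to((\psi\to\chi)\to(\varphi\to\chi))$; $(\varphi\&\psi)\to\varphi$; $(\varphi\&\psi)\to(\psi\&\varphi)$; $(\varphi\land\psi)\to\varphi$; $(\varphi\land\psi)\to(\psi\land\varphi)$; $(\varphi\&(\varphi\to\psi))\to(\psi\land\varphi)$; $(\varphi\to(\psi\to\chi))\to((\varphi\&\psi)\to\chi)$; $((\varphi\&\psi)\to\chi)\to(\varphi\to(\psi\to\chi))$; $((\varphi\to\psi)\to\chi)\to(((\psi\to\varphi)\to\chi)\to\chi)$; $\bot\to\varphi$. The only rule is modus ponens. An axiomatic extension $L$ of $\mathrm{MTL}$ is a logic obtained from $\mathrm{MTL}$ by adding axiom schemata; $\vdash_L$ denotes provability in $L$. $L$ is $n$-contractive if $\vdash_L\varphi^n\to\varphi^{n+1}$ for every formula $\varphi$. An $\mathrm{MTL}$-algebra is an algebra $\langle A,*,\Rightarrow,\sqcap,\sqcup,0,1\rangle$ such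 that $\langle A,\sqcap,\sqcup,0,1\rangle$ is a bounded lattice with minimum $0$ and maximum $1$ (with lattice order $\le$), $\langle A,*,1\rangle$ is a commutative monoid, $z*x\le y$ iff $z\le x\Rightarrow y$ for all $x,y,z$, and $(x\Rightarrow y)\sqcup(y\Rightarrow x)=1$ for all $x,y$. Evaluations interpret $\&,\land,\to,\bot$ by $*,\sqcap,\Rightarrow,0$ respectively. An $L$-algebra is an $\mathrm{MTL}$-algebra in which every theorem of $L$ always takes value $1$; the $L$-algebras form a variety. An $L$-chain is a totally ordered $L$-algebra. An $L$-algebra is generic if it generates the variety of $L$-algebras (equivalently, $L$ is complete with respect to it). Subdirectly irreducible is meant in the usual sense of universal algebra: an algebra $\mathcal{A}$ is subdirectly irreducible if for every embedding of $\mathcal{A}$ into a direct product of algebras whose composition with each projection is surjective, the composition with some projection is an isomorphism. $L$ enjoys the single chain completeness if there is an $L$-chain $\mathcal{A}$ such that $L$ is complete with respect to $\mathcal{A}$, i.e. for every formula $\varphi$, $\vdash_L\varphi$ iff every evaluation into $\mathcal{A}$ gives $\varphi$ the value $1$. $L$ enjoys the subdirect single chain completeness if there is a generic subdirectly irreducible $L$-algebra. *)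

theory Defs
  imports "HOL-Algebra.Group" "HOL-Library.Infinite_Typeclass" "HOL-Library.Countable_Set"
begin

section \<open>Formulas and axiomatic extensions of MTL\<close>

datatype fm =
    Var nat
  | Bot  (\<open>\<^bold>\<bottom>\<close>)
  | Conj fm fm  (infixr \<open>\<^bold>&\<close> 65)
  | Meet fm fm  (infixr \<open>\<^bold>\<and>\<close> 65)
  | Imp fm fm  (infixr \<open>\<^bold>\<rightarrow>\<close> 60)

primrec subst :: "(nat \<Rightarrow> fm) \<Rightarrow> fm \<Rightarrow> fm" where
  "subst \<sigma> (Var k) = \<sigma> k"
| "subst \<sigma> \<^bold>\<bottom> = \<^bold>\<bottom>"
| "subst \<sigma> (\<phi> \<^bold>& \<psi>) = subst \<sigma> \<phi> \<^bold>& subst \<sigma> \<psi>"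
| "subst \<sigma> (\<phi> \<^bold>\<and> \<psi>) = subst \<sigma> \<phi> \<^bold>\<and> subst \<sigma> \<psi>"
| "subst \<sigma> (\<phi> \<^bold>\<rightarrow> \<psi>) = subst \<sigma> \<phi> \<^bold>\<rightarrow> subst \<sigma> \<psi>"

text \<open>The value at exponent 0 is a convention (a provable formula); only positive exponents
  are meaningful.\<close>

fun fm_power :: "fm \<Rightarrow> nat \<Rightarrow> fm" where
  "fm_power \<phi> 0 = \<^bold>\<bottom> \<^bold>\<rightarrow> \<^bold>\<bottom>"
| "fm_power \<phi> (Suc 0) = \<phi>"
| "fm_power \<phi> (Suc (Suc k)) = fm_power \<phi> (Suc k) \<^bold>& \<phi>"

inductive mtl_axiom :: "fm \<Rightarrow> bool" where
  "mtl_axiom ((\<phi> \<^bold>\<rightarrow> \<psi>) \<^bold>\<rightarrow> ((\<psi> \<^bold>\<rightarrow> \<chi>) \<^bold>\<rightarrow> (\<phi> \<^bold>\<rightarrow> \<chi>)))"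
| "mtl_axiom ((\<phi> \<^bold>& \<psi>) \<^bold>\<rightarrow> \<phi>)"
| "mtl_axiom ((\<phi> \<^bold>& \<psi>) \<^bold>\<rightarrow> (\<psi> \<^bold>& \<phi>))"
| "mtl_axiom ((\<phi> \<^bold>\<and> \<psi>) \<^bold>\<rightarrow> \<phi>)"
| "mtl_axiom ((\<phi> \<^bold>\<and> \<psi>) \<^bold>\<rightarrow> (\<psi> \<^bold>\<and> \<phi>))"
| "mtl_axiom ((\<phi> \<^bold>& (\<phi> \<^bold>\<rightarrow> \<psi>)) \<^bold>\<rightarrow> (\<psi> \<^bold>\<and> \<phi>))"
| "mtl_axiom ((\<phi> \<^bold>\<rightarrow> (\<psi> \<^bold>\<rightarrow> \<chi>)) \<^bold>\<rightarrow> ((\<phi> \<^bold>& \<psi>) \<^bold>\<rightarrow> \<chi>))"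
| "mtl_axiom (((\<phi> \<^bold>& \<psi>) \<^bold>\<rightarrow> \<chi>) \<^bold>\<rightarrow> (\<phi> \<^bold>\<rightarrow> (\<psi> \<^bold>\<rightarrow> \<chi>)))"
| "mtl_axiom (((\<phi> \<^bold>\<rightarrow> \<psi>) \<^bold>\<rightarrow> \<chi>) \<^bold>\<rightarrow> (((\<psi> \<^bold>\<rightarrow> \<phi>) \<^bold>\<rightarrow> \<chi>) \<^bold>\<rightarrow> \<chi>))"
| "mtl_axiom (\<^bold>\<bottom> \<^bold>\<rightarrow> \<phi>)"

text \<open>An axiomatic extension \<open>L\<close> is presented by the set of its additional axiom schemata: a
  schema is given by a formula whose variables act as metavariables, so that all its substitution
  instances are axioms. The set may be infinite.\<close>

inductive provable :: "fm set \<Rightarrow> fm \<Rightarrow> bool"  (infix \<open>\<turnstile>\<close> 50) for L where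
  mtl: "mtl_axiom \<phi> \<Longrightarrow> L \<turnstile> \<phi>"
| schema: "\<phi> \<in> L \<Longrightarrow> L \<turnstile> subst \<sigma> \<phi>"
| modus_ponens: "L \<turnstile> \<phi> \<^bold>\<rightarrow> \<psi> \<Longrightarrow> L \<turnstile> \<phi> \<Longrightarrow> L \<turnstile> \<psi>"

definition contractive :: "nat \<Rightarrow> fm set \<Rightarrow> bool" where
  "contractive n L \<longleftrightarrow> (\<forall>\<phi>. L \<turnstile> fm_power \<phi> n \<^bold>\<rightarrow> fm_power \<phi> (n + 1))"

section \<open>Algebras\<close>

text \<open>Algebras in the signature of MTL. The monoid part \<open>\<otimes>, \<one>\<close> is that of HOL-Algebra; \<open>\<one>\<close> is
  also the maximum of the lattice.\<close>

record 'a mtl_struct = "'a monoid" +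
  resid :: "'a \<Rightarrow> 'a \<Rightarrow> 'a"  (infixr \<open>\<leadsto>\<index>\<close> 65)
  inf_op :: "'a \<Rightarrow> 'a \<Rightarrow> 'a"  (infixl \<open>\<curlywedge>\<index>\<close> 70)
  sup_op :: "'a \<Rightarrow> 'a \<Rightarrow> 'a"  (infixl \<open>\<curlyvee>\<index>\<close> 70)
  zero :: 'a  (\<open>\<zero>\<index>\<close>)

locale sig_algebra =
  fixes A :: "'a mtl_struct" (structure)
  assumes one_in: "\<one> \<in> carrier A"
    and zero_in: "\<zero> \<in> carrier A"
    and mult_in: "\<lbrakk>x \<in> carrier A; y \<in> carrier A\<rbrakk> \<Longrightarrow> x \<otimes> y \<in> carrier A"
    and resid_in: "\<lbrakk>x \<in> carrier A; y \<in> carrier A\<rbrakk> \<Longrightarrow> x \<leadsto> y \<in> carrier A"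
    and inf_in: "\<lbrakk>x \<in> carrier A; y \<in> carrier A\<rbrakk> \<Longrightarrow> x \<curlywedge> y \<in> carrier A"
    and sup_in: "\<lbrakk>x \<in> carrier A; y \<in> carrier A\<rbrakk> \<Longrightarrow> x \<curlyvee> y \<in> carrier A"

definition alg_le :: "'a mtl_struct \<Rightarrow> 'a \<Rightarrow> 'a \<Rightarrow> bool" where
  "alg_le A x y \<longleftrightarrow> x \<curlywedge>\<^bsub>A\<^esub> y = x"

locale mtl_algebra = sig_algebra A + comm_monoid A for A :: "'a mtl_struct" (structure) +
  assumes inf_commute: "\<lbrakk>x \<in> carrier A; y \<in> carrier A\<rbrakk> \<Longrightarrow> x \<curlywedge> y = y \<curlywedge> x"
    and sup_commute: "\<lbrakk>x \<in> carrier A; y \<in> carrier A\<rbrakk> \<Longrightarrow> x \<curlyvee> y = y \<curlyvee> x"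
    and inf_assoc: "\<lbrakk>x \<in> carrier A; y \<in> carrier A; z \<in> carrier A\<rbrakk> \<Longrightarrow>
          (x \<curlywedge> y) \<curlywedge> z = x \<curlywedge> (y \<curlywedge> z)"
    and sup_assoc: "\<lbrakk>x \<in> carrier A; y \<in> carrier A; z \<in> carrier A\<rbrakk> \<Longrightarrow>
          (x \<curlyvee> y) \<curlyvee> z = x \<curlyvee> (y \<curlyvee> z)"
    and inf_sup_absorb: "\<lbrakk>x \<in> carrier A; y \<in> carrier A\<rbrakk> \<Longrightarrow> x \<curlywedge> (x \<curlyvee> y) = x"
    and sup_inf_absorb: "\<lbrakk>x \<in> carrier A; y \<in> carrier A\<rbrakk> \<Longrightarrow> x \<curlyvee> (x \<curlywedge> y) = x"
    and zero_le: "x \<in> carrier A \<Longrightarrow> alg_le A \<zero> x"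
    and le_one: "x \<in> carrier A \<Longrightarrow> alg_le A x \<one>"
    and residuation: "\<lbrakk>x \<in> carrier A; y \<in> carrier A; z \<in> carrier A\<rbrakk> \<Longrightarrow>
          alg_le A (z \<otimes> x) y \<longleftrightarrow> alg_le A z (x \<leadsto> y)"
    and prelinearity: "\<lbrakk>x \<in> carrier A; y \<in> carrier A\<rbrakk> \<Longrightarrow> (x \<leadsto> y) \<curlyvee> (y \<leadsto> x) = \<one>"

definition totally_ordered :: "'a mtl_struct \<Rightarrow> bool" where
  "totally_ordered A \<longleftrightarrow> (\<forall>x\<in>carrier A. \<forall>y\<in>carrier A. alg_le A x y \<or> alg_le A y x)"

primrec eval :: "'a mtl_struct \<Rightarrow> (nat \<Rightarrow> 'a) \<Rightarrow> fm \<Rightarrow> 'a" where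
  "eval A v (Var k) = v k"
| "eval A v \<^bold>\<bottom> = \<zero>\<^bsub>A\<^esub>"
| "eval A v (\<phi> \<^bold>& \<psi>) = eval A v \<phi> \<otimes>\<^bsub>A\<^esub> eval A v \<psi>"
| "eval A v (\<phi> \<^bold>\<and> \<psi>) = eval A v \<phi> \<curlywedge>\<^bsub>A\<^esub> eval A v \<psi>"
| "eval A v (\<phi> \<^bold>\<rightarrow> \<psi>) = eval A v \<phi> \<leadsto>\<^bsub>A\<^esub> eval A v \<psi>"

definition valid_in :: "'a mtl_struct \<Rightarrow> fm \<Rightarrow> bool" where
  "valid_in A \<phi> \<longleftrightarrow> (\<forall>v \<in> UNIV \<rightarrow> carrier A. eval A v \<phi> = \<one>\<^bsub>A\<^esub>)"

definition L_algebra :: "fm set \<Rightarrow> 'a mtl_struct \<Rightarrow> bool" where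
  "L_algebra L A \<longleftrightarrow> mtl_algebra A \<and> (\<forall>\<phi>. L \<turnstile> \<phi> \<longrightarrow> valid_in A \<phi>)"

definition L_chain :: "fm set \<Rightarrow> 'a mtl_struct \<Rightarrow> bool" where
  "L_chain L A \<longleftrightarrow> L_algebra L A \<and> totally_ordered A"

definition complete_wrt :: "fm set \<Rightarrow> 'a mtl_struct \<Rightarrow> bool" where
  "complete_wrt L A \<longleftrightarrow> (\<forall>\<phi>. L \<turnstile> \<phi> \<longleftrightarrow> valid_in A \<phi>)"

section \<open>Generic algebras\<close>

text \<open>Terms of the full algebraic signature. They differ from formulas, which lack \<open>\<curlyvee>\<close> and \<open>\<one>\<close>.\<close>

datatype trm = TVar nat | TOne | TZero
  | TMult trm trm | TResid trm trm | TInf trm trm | TSup trm trm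

instance trm :: countable
  by countable_datatype

primrec term_eval :: "'a mtl_struct \<Rightarrow> (nat \<Rightarrow> 'a) \<Rightarrow> trm \<Rightarrow> 'a" where
  "term_eval A v (TVar k) = v k"
| "term_eval A v TOne = \<one>\<^bsub>A\<^esub>"
| "term_eval A v TZero = \<zero>\<^bsub>A\<^esub>"
| "term_eval A v (TMult s t) = term_eval A v s \<otimes>\<^bsub>A\<^esub> term_eval A v t"
| "term_eval A v (TResid s t) = term_eval A v s \<leadsto>\<^bsub>A\<^esub> term_eval A v t"
| "term_eval A v (TInf s t) = term_eval A v s \<curlywedge>\<^bsub>A\<^esub> term_eval A v t"
| "term_eval A v (TSup s t) = term_eval A v s \<curlyvee>\<^bsub>A\<^esub> term_eval A v t"

definition satisfies_eq :: "'a mtl_struct \<Rightarrow> trm \<Rightarrow> trm \<Rightarrow> bool" where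
  "satisfies_eq A s t \<longleftrightarrow> (\<forall>v \<in> UNIV \<rightarrow> carrier A. term_eval A v s = term_eval A v t)"

text \<open>Varieties are understood as equational classes, so the variety generated by \<open>A\<close> consists of
  the algebras satisfying all equations true in \<open>A\<close>. It is formed here over the type \<open>'a\<close> of \<open>A\<close>;
  the lemma \<open>generic_any_type\<close> shows that for infinite \<open>'a\<close> the resulting notion
  of a generic algebra does not depend on this choice.\<close>

definition generated_variety :: "'a mtl_struct \<Rightarrow> 'a mtl_struct set" where
  "generated_variety A =
     {C. sig_algebra C \<and> (\<forall>s t. satisfies_eq A s t \<longrightarrow> satisfies_eq C s t)}"

definition generic :: "fm set \<Rightarrow> 'a mtl_struct \<Rightarrow> bool" where
  "generic L A \<longleftrightarrow> L_algebra L A \<and> generated_variety A = {C. L_algebra L C}"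

section \<open>Subdirect irreducibility\<close>

definition alg_hom :: "'a mtl_struct \<Rightarrow> 'b mtl_struct \<Rightarrow> ('a \<Rightarrow> 'b) set" where
  "alg_hom A B = {h \<in> hom A B.
     h \<one>\<^bsub>A\<^esub> = \<one>\<^bsub>B\<^esub> \<and> h \<zero>\<^bsub>A\<^esub> = \<zero>\<^bsub>B\<^esub> \<and>
     (\<forall>x\<in>carrier A. \<forall>y\<in>carrier A.
        h (x \<leadsto>\<^bsub>A\<^esub> y) = h x \<leadsto>\<^bsub>B\<^esub> h y \<and>
        h (x \<curlywedge>\<^bsub>A\<^esub> y) = h x \<curlywedge>\<^bsub>B\<^esub> h y \<and>
        h (x \<curlyvee>\<^bsub>A\<^esub> y) = h x \<curlyvee>\<^bsub>B\<^esub> h y)}"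

definition embedding :: "'a mtl_struct \<Rightarrow> 'b mtl_struct \<Rightarrow> ('a \<Rightarrow> 'b) set" where
  "embedding A B = {h \<in> alg_hom A B. inj_on h (carrier A)}"

definition alg_iso :: "'a mtl_struct \<Rightarrow> 'b mtl_struct \<Rightarrow> ('a \<Rightarrow> 'b) set" where
  "alg_iso A B = {h \<in> alg_hom A B. bij_betw h (carrier A) (carrier B)}"

definition direct_product :: "'i set \<Rightarrow> ('i \<Rightarrow> 'b mtl_struct) \<Rightarrow> ('i \<Rightarrow> 'b) mtl_struct" where
  "direct_product I B =
     \<lparr>carrier = (\<Pi>\<^sub>E i\<in>I. carrier (B i)),
      monoid.mult = (\<lambda>f g. \<lambda>i\<in>I. f i \<otimes>\<^bsub>B i\<^esub> g i),
      one = (\<lambda>i\<in>I. \<one>\<^bsub>B i\<^esub>),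
      resid = (\<lambda>f g. \<lambda>i\<in>I. f i \<leadsto>\<^bsub>B i\<^esub> g i),
      inf_op = (\<lambda>f g. \<lambda>i\<in>I. f i \<curlywedge>\<^bsub>B i\<^esub> g i),
      sup_op = (\<lambda>f g. \<lambda>i\<in>I. f i \<curlyvee>\<^bsub>B i\<^esub> g i),
      zero = (\<lambda>i\<in>I. \<zero>\<^bsub>B i\<^esub>)\<rparr>"

definition subdirect_embedding ::
    "'a mtl_struct \<Rightarrow> 'i set \<Rightarrow> ('i \<Rightarrow> 'b mtl_struct) \<Rightarrow> ('a \<Rightarrow> 'i \<Rightarrow> 'b) \<Rightarrow> bool" where
  "subdirect_embedding A I B \<alpha> \<longleftrightarrow>
     (\<forall>i\<in>I. sig_algebra (B i)) \<and> \<alpha> \<in> embedding A (direct_product I B) \<and>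
     (\<forall>i\<in>I. (\<lambda>x. \<alpha> x i) ` carrier A = carrier (B i))"

text \<open>Products are over nonempty families, so that a trivial algebra counts as subdirectly
  irreducible (as in Burris and Sankappanavar). The type of the index set and that of the factors
  are fixed because HOL cannot quantify over types, but they are no restriction: the types are
  large enough to accommodate all quotients \<open>A/\<theta>\<close>, indexed by \<open>\<theta>\<close>, and the lemma
  \<open>subdirectly_irreducible_any_family\<close> derives the property for index sets and
  factors of any types.\<close>

definition subdirectly_irreducible :: "'a mtl_struct \<Rightarrow> bool" where
  "subdirectly_irreducible A \<longleftrightarrow> sig_algebra A \<and>
     (\<forall>(I :: ('a \<times> 'a) set set) (B :: ('a \<times> 'a) set \<Rightarrow> 'a set mtl_struct) \<alpha>.
        I \<noteq> {} \<and> subdirect_embedding A I B \<alpha> \<longrightarrow>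
        (\<exists>i\<in>I. (\<lambda>x. \<alpha> x i) \<in> alg_iso A (B i)))"

section \<open>Independence of the auxiliary types\<close>

lemma embedding_const:
  assumes "h \<in> embedding D C"
  shows "h \<one>\<^bsub>D\<^esub> = \<one>\<^bsub>C\<^esub>" "h \<zero>\<^bsub>D\<^esub> = \<zero>\<^bsub>C\<^esub>"
  using assms by (auto simp: embedding_def alg_hom_def)

lemma embedding_sig:
  assumes "h \<in> embedding D C" "x \<in> carrier D"
  shows "h x \<in> carrier C"
    "y \<in> carrier D \<Longrightarrow> h (x \<otimes>\<^bsub>D\<^esub> y) = h x \<otimes>\<^bsub>C\<^esub> h y"
    "y \<in> carrier D \<Longrightarrow> h (x \<leadsto>\<^bsub>D\<^esub> y) = h x \<leadsto>\<^bsub>C\<^esub> h y"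
    "y \<in> carrier D \<Longrightarrow> h (x \<curlywedge>\<^bsub>D\<^esub> y) = h x \<curlywedge>\<^bsub>C\<^esub> h y"
    "y \<in> carrier D \<Longrightarrow> h (x \<curlyvee>\<^bsub>D\<^esub> y) = h x \<curlyvee>\<^bsub>C\<^esub> h y"
  using assms by (auto simp: embedding_def alg_hom_def hom_def Pi_iff)

lemma term_eval_in:
  assumes "sig_algebra D" "v \<in> UNIV \<rightarrow> carrier D"
  shows "term_eval D v t \<in> carrier D"
proof -
  interpret sig_algebra D by fact
  show ?thesis
    using assms(2) by (induction t) (auto simp: one_in zero_in mult_in resid_in inf_in sup_in)
qed

lemma eval_in:
  assumes "sig_algebra D" "v \<in> UNIV \<rightarrow> carrier D"
  shows "eval D v \<phi> \<in> carrier D"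
proof -
  interpret sig_algebra D by fact
  show ?thesis
    using assms(2) by (induction \<phi>) (auto simp: zero_in mult_in resid_in inf_in)
qed

lemma term_eval_embedding:
  assumes "sig_algebra D" "h \<in> embedding D C" "v \<in> UNIV \<rightarrow> carrier D"
  shows "h (term_eval D v t) = term_eval C (\<lambda>k. h (v k)) t"
  by (induction t)
    (auto simp: term_eval_in[OF assms(1,3)] embedding_sig[OF assms(2)] embedding_const[OF assms(2)])

lemma eval_embedding:
  assumes "sig_algebra D" "h \<in> embedding D C" "v \<in> UNIV \<rightarrow> carrier D"
  shows "h (eval D v \<phi>) = eval C (\<lambda>k. h (v k)) \<phi>"
  by (induction \<phi>)
    (auto simp: eval_in[OF assms(1,3)] embedding_sig[OF assms(2)] embedding_const[OF assms(2)])

lemma embedding_eq_iff: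
  "h \<in> embedding D C \<Longrightarrow> x \<in> carrier D \<Longrightarrow> y \<in> carrier D \<Longrightarrow> x = y \<longleftrightarrow> h x = h y"
  by (auto simp: embedding_def inj_on_def)

lemma satisfies_eq_sub:
  assumes "sig_algebra D" "h \<in> embedding D C" "satisfies_eq C s t"
  shows "satisfies_eq D s t"
  unfolding satisfies_eq_def
proof
  fix v :: "nat \<Rightarrow> 'a" assume v: "v \<in> UNIV \<rightarrow> carrier D"
  have "(\<lambda>k. h (v k)) \<in> UNIV \<rightarrow> carrier C"
    using v embedding_sig(1)[OF assms(2)] by auto
  then show "term_eval D v s = term_eval D v t"
    using assms(3) term_eval_embedding[OF assms(1,2) v]
    by (simp add: embedding_eq_iff[OF assms(2)] term_eval_in[OF assms(1) v] satisfies_eq_def)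
qed

lemma mtl_algebra_sub:
  assumes "sig_algebra D" "h \<in> embedding D C" "mtl_algebra C"
  shows "mtl_algebra D"
proof -
  interpret D: sig_algebra D by fact
  interpret C: mtl_algebra C by fact
  note emb = embedding_sig[OF assms(2)] embedding_const[OF assms(2)]
    embedding_eq_iff[OF assms(2)]
  note D_in = D.one_in D.zero_in D.mult_in D.resid_in D.inf_in D.sup_in
  have le: "alg_le D x y \<longleftrightarrow> alg_le C (h x) (h y)" if "x \<in> carrier D" "y \<in> carrier D" for x y
    using that D_in by (simp add: alg_le_def emb)
  show ?thesis
  proof
    show "\<And>x y z. x \<in> carrier D \<Longrightarrow> y \<in> carrier D \<Longrightarrow> z \<in> carrier D \<Longrightarrow>
        x \<otimes>\<^bsub>D\<^esub> y \<otimes>\<^bsub>D\<^esub> z = x \<otimes>\<^bsub>D\<^esub> (y \<otimes>\<^bsub>D\<^esub> z)"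
      by (simp add: emb D_in C.m_assoc)
    show "\<And>x y. x \<in> carrier D \<Longrightarrow> y \<in> carrier D \<Longrightarrow> x \<otimes>\<^bsub>D\<^esub> y = y \<otimes>\<^bsub>D\<^esub> x"
      by (simp add: emb D_in C.m_comm)
    show "\<And>x y z. x \<in> carrier D \<Longrightarrow> y \<in> carrier D \<Longrightarrow> z \<in> carrier D \<Longrightarrow>
        alg_le D (z \<otimes>\<^bsub>D\<^esub> x) y = alg_le D z (x \<leadsto>\<^bsub>D\<^esub> y)"
      by (simp add: emb le D_in C.residuation)
  qed (simp_all add: emb le D_in C.inf_commute C.sup_commute C.inf_assoc C.sup_assoc
        C.inf_sup_absorb C.sup_inf_absorb C.zero_le C.le_one C.prelinearity)
qed

lemma L_algebra_sub:
  assumes "sig_algebra D" "h \<in> embedding D C" "L_algebra L C"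
  shows "L_algebra L D"
  unfolding L_algebra_def valid_in_def
proof (intro conjI allI impI ballI)
  show "mtl_algebra D"
    using assms mtl_algebra_sub by (auto simp: L_algebra_def)
next
  fix \<phi> and v :: "nat \<Rightarrow> 'a" assume \<phi>: "L \<turnstile> \<phi>" and v: "v \<in> UNIV \<rightarrow> carrier D"
  have "(\<lambda>k. h (v k)) \<in> UNIV \<rightarrow> carrier C"
    using v embedding_sig(1)[OF assms(2)] by auto
  then have "eval C (\<lambda>k. h (v k)) \<phi> = \<one>\<^bsub>C\<^esub>"
    using \<phi> assms(3) by (simp add: L_algebra_def valid_in_def)
  then show "eval D v \<phi> = \<one>\<^bsub>D\<^esub>"
    using eval_embedding[OF assms(1,2) v] sig_algebra.one_in[OF assms(1)]
    by (simp add: embedding_eq_iff[OF assms(2)] eval_in[OF assms(1) v] embedding_const[OF assms(2)])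
qed

definition transport :: "('a \<Rightarrow> 'b) \<Rightarrow> 'a mtl_struct \<Rightarrow> 'b mtl_struct" where
  "transport f A = (let g = inv_into (carrier A) f in
     \<lparr>carrier = f ` carrier A,
      monoid.mult = (\<lambda>x y. f (g x \<otimes>\<^bsub>A\<^esub> g y)),
      one = f \<one>\<^bsub>A\<^esub>,
      resid = (\<lambda>x y. f (g x \<leadsto>\<^bsub>A\<^esub> g y)),
      inf_op = (\<lambda>x y. f (g x \<curlywedge>\<^bsub>A\<^esub> g y)),
      sup_op = (\<lambda>x y. f (g x \<curlyvee>\<^bsub>A\<^esub> g y)),
      zero = f \<zero>\<^bsub>A\<^esub>\<rparr>)"

lemma transport:
  assumes "sig_algebra A" "inj_on f (carrier A)"
  shows "sig_algebra (transport f A)" "carrier (transport f A) = f ` carrier A"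
    "inv_into (carrier A) f \<in> embedding (transport f A) A" "f \<in> alg_hom A (transport f A)"
proof -
  interpret sig_algebra A by fact
  note [simp] = one_in zero_in mult_in resid_in inf_in sup_in inv_into_f_f[OF assms(2)]
  show "sig_algebra (transport f A)" "carrier (transport f A) = f ` carrier A"
    "f \<in> alg_hom A (transport f A)"
    by (auto simp: transport_def Let_def sig_algebra_def alg_hom_def hom_def)
  show "inv_into (carrier A) f \<in> embedding (transport f A) A"
    by (auto simp: transport_def Let_def embedding_def alg_hom_def hom_def inj_on_def)
qed

lemma countable_copy:
  fixes C :: "'c mtl_struct"
  assumes C: "sig_algebra C" and v: "(v :: nat \<Rightarrow> 'c) \<in> UNIV \<rightarrow> carrier C"
  obtains D :: "'a::infinite mtl_struct" and h w
    where "sig_algebra D" "h \<in> embedding D C" "w \<in> UNIV \<rightarrow> carrier D" "v = (\<lambda>k. h (w k))"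
proof -
  interpret sig_algebra C by fact
  define S where "S = range (term_eval C v)"
  define C' where "C' = C\<lparr>carrier := S\<rparr>"
  have ev [simp]: "term_eval C v t \<in> carrier C" for t
    using term_eval_in[OF C v] .
  have S: "S \<subseteq> carrier C"
    by (auto simp: S_def)
  have vS: "v k \<in> S" for k
    unfolding S_def by (rule range_eqI[of _ _ "TVar k"]) simp
  have C': "sig_algebra C'"
    unfolding sig_algebra_def C'_def S_def
    by (auto intro: range_eqI[of _ _ TOne] range_eqI[of _ _ TZero]
        range_eqI[of _ _ "TMult s t" for s t] range_eqI[of _ _ "TResid s t" for s t]
        range_eqI[of _ _ "TInf s t" for s t] range_eqI[of _ _ "TSup s t" for s t])
  obtain e :: "nat \<Rightarrow> 'a" where e: "inj e"
    using infinite_countable_subset[OF infinite_UNIV] by blast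
  define f where "f = (\<lambda>x. e (to_nat_on S x))"
  have "countable S"
    by (simp add: S_def)
  then have f: "inj_on f (carrier C')"
    using comp_inj_on[OF inj_on_to_nat_on inj_on_subset[OF e]]
    by (auto simp: f_def C'_def comp_def)
  let ?D = "transport f C'" and ?h = "inv_into (carrier C') f"
  show thesis
  proof (rule that)
    show "sig_algebra ?D" using transport(1)[OF C' f] .
    show "?h \<in> embedding ?D C"
      using transport(3)[OF C' f] S
      by (auto simp: embedding_def alg_hom_def hom_def C'_def)
    show "(\<lambda>k. f (v k)) \<in> UNIV \<rightarrow> carrier ?D"
      using transport(2)[OF C' f] vS by (auto simp: C'_def)
    show "v = (\<lambda>k. ?h (f (v k)))"
      using vS inv_into_f_f[OF f] by (auto simp: C'_def)
  qed
qed

lemma mtl_algebra_local: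
  fixes C :: "'c mtl_struct"
  assumes C: "sig_algebra C"
    and D: "\<And>(D :: 'a::infinite mtl_struct) h.
              \<lbrakk>sig_algebra D; h \<in> embedding D C\<rbrakk> \<Longrightarrow> mtl_algebra D"
  shows "mtl_algebra C"
proof -
  interpret sig_algebra C by fact
  note C_in = one_in zero_in mult_in resid_in inf_in sup_in
  have *: "x \<otimes>\<^bsub>C\<^esub> y = y \<otimes>\<^bsub>C\<^esub> x \<and> \<one>\<^bsub>C\<^esub> \<otimes>\<^bsub>C\<^esub> x = x \<and> x \<otimes>\<^bsub>C\<^esub> \<one>\<^bsub>C\<^esub> = x \<and>
      x \<otimes>\<^bsub>C\<^esub> y \<otimes>\<^bsub>C\<^esub> z = x \<otimes>\<^bsub>C\<^esub> (y \<otimes>\<^bsub>C\<^esub> z) \<and>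
      x \<curlywedge>\<^bsub>C\<^esub> y = y \<curlywedge>\<^bsub>C\<^esub> x \<and> x \<curlyvee>\<^bsub>C\<^esub> y = y \<curlyvee>\<^bsub>C\<^esub> x \<and>
      x \<curlywedge>\<^bsub>C\<^esub> y \<curlywedge>\<^bsub>C\<^esub> z = x \<curlywedge>\<^bsub>C\<^esub> (y \<curlywedge>\<^bsub>C\<^esub> z) \<and>
      x \<curlyvee>\<^bsub>C\<^esub> y \<curlyvee>\<^bsub>C\<^esub> z = x \<curlyvee>\<^bsub>C\<^esub> (y \<curlyvee>\<^bsub>C\<^esub> z) \<and>
      x \<curlywedge>\<^bsub>C\<^esub> (x \<curlyvee>\<^bsub>C\<^esub> y) = x \<and> x \<curlyvee>\<^bsub>C\<^esub> (x \<curlywedge>\<^bsub>C\<^esub> y) = x \<and>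
      alg_le C \<zero>\<^bsub>C\<^esub> x \<and> alg_le C x \<one>\<^bsub>C\<^esub> \<and>
      (alg_le C (z \<otimes>\<^bsub>C\<^esub> x) y \<longleftrightarrow> alg_le C z (x \<leadsto>\<^bsub>C\<^esub> y)) \<and>
      (x \<leadsto>\<^bsub>C\<^esub> y) \<curlyvee>\<^bsub>C\<^esub> (y \<leadsto>\<^bsub>C\<^esub> x) = \<one>\<^bsub>C\<^esub>"
    if xyz: "x \<in> carrier C" "y \<in> carrier C" "z \<in> carrier C" for x y z
  proof -
    define v where "v = (\<lambda>k::nat. if k = 0 then x else if k = 1 then y else z)"
    have "v \<in> UNIV \<rightarrow> carrier C"
      using xyz by (auto simp: v_def)
    then obtain D :: "'a mtl_struct" and h w where
      D': "sig_algebra D" and h: "h \<in> embedding D C" and w: "w \<in> UNIV \<rightarrow> carrier D"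
      and vw: "v = (\<lambda>k. h (w k))"
      using countable_copy[OF C] by blast
    interpret D: mtl_algebra D using D[OF D' h] .
    note D_in = D.one_in D.zero_in D.mult_in D.resid_in D.inf_in D.sup_in
    have xyz_eq: "x = h (w 0)" "y = h (w 1)" "z = h (w 2)"
      using fun_cong[OF vw, of 0] fun_cong[OF vw, of 1] fun_cong[OF vw, of 2]
      by (simp_all add: v_def)
    have w_in: "w k \<in> carrier D" for k
      using w by auto
    have h1: "\<one>\<^bsub>C\<^esub> = h \<one>\<^bsub>D\<^esub>" and h0: "\<zero>\<^bsub>C\<^esub> = h \<zero>\<^bsub>D\<^esub>"
      using embedding_const[OF h] by simp_all
    note lift = embedding_sig(2-5)[OF h, symmetric] embedding_eq_iff[OF h, symmetric]
    have le: "alg_le C (h a) (h b) \<longleftrightarrow> alg_le D a b" if "a \<in> carrier D" "b \<in> carrier D" for a b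
      using that by (simp add: alg_le_def lift D_in)
    show ?thesis
      unfolding xyz_eq h1 h0
      by (simp add: lift le D_in w_in D.m_assoc D.inf_assoc D.sup_assoc
          D.inf_sup_absorb D.sup_inf_absorb D.zero_le D.le_one D.residuation D.prelinearity)
        (simp add: D.m_comm D.inf_commute D.sup_commute w_in)
  qed
  show ?thesis
    using * C_in by unfold_locales blast+
qed

lemma equational_class_transfer:
  assumes "\<And>D :: 'a::infinite mtl_struct. L_algebra L D \<longleftrightarrow>
             sig_algebra D \<and> (\<forall>s t. E s t \<longrightarrow> satisfies_eq D s t)"
  shows "L_algebra L (C :: 'c mtl_struct) \<longleftrightarrow>
           sig_algebra C \<and> (\<forall>s t. E s t \<longrightarrow> satisfies_eq C s t)"
proof
  assume L: "L_algebra L C"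
  then have C: "sig_algebra C"
    by (simp add: L_algebra_def mtl_algebra_def)
  have "satisfies_eq C s t" if "E s t" for s t
    unfolding satisfies_eq_def
  proof
    fix v :: "nat \<Rightarrow> 'c" assume "v \<in> UNIV \<rightarrow> carrier C"
    then obtain D :: "'a mtl_struct" and h w where
      D: "sig_algebra D" and h: "h \<in> embedding D C" and w: "w \<in> UNIV \<rightarrow> carrier D"
      and vw: "v = (\<lambda>k. h (w k))"
      using countable_copy[OF C] by blast
    have "satisfies_eq D s t"
      using L_algebra_sub[OF D h L] assms that by blast
    then show "term_eval C v s = term_eval C v t"
      using w by (simp add: vw term_eval_embedding[OF D h w, symmetric] satisfies_eq_def)
  qed
  with C show "sig_algebra C \<and> (\<forall>s t. E s t \<longrightarrow> satisfies_eq C s t)"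
    by blast
next
  assume *: "sig_algebra C \<and> (\<forall>s t. E s t \<longrightarrow> satisfies_eq C s t)"
  then have C: "sig_algebra C" by blast
  have LD: "L_algebra L D" if "sig_algebra D" "h \<in> embedding D C" for D :: "'a mtl_struct" and h
    using assms * that satisfies_eq_sub by blast
  show "L_algebra L C"
    unfolding L_algebra_def valid_in_def
  proof (intro conjI allI impI ballI)
    show "mtl_algebra C"
      by (rule mtl_algebra_local[OF C]) (use LD in \<open>auto simp: L_algebra_def\<close>)
  next
    fix \<phi> and v :: "nat \<Rightarrow> 'c" assume \<phi>: "L \<turnstile> \<phi>" and "v \<in> UNIV \<rightarrow> carrier C"
    then obtain D :: "'a mtl_struct" and h w where
      D: "sig_algebra D" and h: "h \<in> embedding D C" and w: "w \<in> UNIV \<rightarrow> carrier D"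
      and vw: "v = (\<lambda>k. h (w k))"
      using countable_copy[OF C] by blast
    have "eval D w \<phi> = \<one>\<^bsub>D\<^esub>"
      using LD[OF D h] \<phi> w by (simp add: L_algebra_def valid_in_def)
    moreover have "h \<one>\<^bsub>D\<^esub> = \<one>\<^bsub>C\<^esub>"
      using embedding_const[OF h] by simp
    ultimately show "eval C v \<phi> = \<one>\<^bsub>C\<^esub>"
      by (simp add: vw eval_embedding[OF D h w, symmetric])
  qed
qed

lemma generic_any_type:
  fixes A :: "'a::infinite mtl_struct"
  shows "generic L A \<longleftrightarrow> L_algebra L A \<and>
    (\<forall>C :: 'c::infinite mtl_struct. L_algebra L C \<longleftrightarrow>
       sig_algebra C \<and> (\<forall>s t. satisfies_eq A s t \<longrightarrow> satisfies_eq C s t))"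
proof -
  have "generic L A \<longleftrightarrow> L_algebra L A \<and> (\<forall>C :: 'a mtl_struct. L_algebra L C \<longleftrightarrow>
       sig_algebra C \<and> (\<forall>s t. satisfies_eq A s t \<longrightarrow> satisfies_eq C s t))"
    by (auto simp: generic_def generated_variety_def)
  also have "\<dots> \<longleftrightarrow> L_algebra L A \<and> (\<forall>C :: 'c mtl_struct. L_algebra L C \<longleftrightarrow>
       sig_algebra C \<and> (\<forall>s t. satisfies_eq A s t \<longrightarrow> satisfies_eq C s t))"
  proof (rule conj_cong[OF refl], rule iffI; rule allI)
    fix C :: "'c mtl_struct"
    assume H: "\<forall>C :: 'a mtl_struct. L_algebra L C \<longleftrightarrow>
      sig_algebra C \<and> (\<forall>s t. satisfies_eq A s t \<longrightarrow> satisfies_eq C s t)"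
    show "L_algebra L C \<longleftrightarrow>
      sig_algebra C \<and> (\<forall>s t. satisfies_eq A s t \<longrightarrow> satisfies_eq C s t)"
      by (rule equational_class_transfer[OF spec[OF H]])
  next
    fix C :: "'a mtl_struct"
    assume H: "\<forall>C :: 'c mtl_struct. L_algebra L C \<longleftrightarrow>
      sig_algebra C \<and> (\<forall>s t. satisfies_eq A s t \<longrightarrow> satisfies_eq C s t)"
    show "L_algebra L C \<longleftrightarrow>
      sig_algebra C \<and> (\<forall>s t. satisfies_eq A s t \<longrightarrow> satisfies_eq C s t)"
      by (rule equational_class_transfer[OF spec[OF H]])
  qed
  finally show ?thesis .
qed

lemma subdirectly_irreducible_any_family:
  fixes A :: "'a mtl_struct" and I :: "'i set" and B :: "'i \<Rightarrow> 'b mtl_struct"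
  assumes si: "subdirectly_irreducible A" and "I \<noteq> {}" and sub: "subdirect_embedding A I B \<alpha>"
  shows "\<exists>i\<in>I. (\<lambda>x. \<alpha> x i) \<in> alg_iso A (B i)"
proof -
  have B: "sig_algebra (B i)" and onto: "(\<lambda>x. \<alpha> x i) ` carrier A = carrier (B i)" if "i \<in> I" for i
    using sub that by (auto simp: subdirect_embedding_def)
  have \<alpha>: "\<alpha> \<in> embedding A (direct_product I B)"
    using sub by (simp add: subdirect_embedding_def)
  have hom: "(\<lambda>x. \<alpha> x i) \<in> alg_hom A (B i)" if "i \<in> I" for i
    using \<alpha> that
    by (auto simp: embedding_def alg_hom_def hom_def direct_product_def PiE_iff Pi_iff)
  define K where "K i = {(x, y). x \<in> carrier A \<and> y \<in> carrier A \<and> \<alpha> x i = \<alpha> y i}" for i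
  define r where "r \<theta> = inv_into I K \<theta>" for \<theta>
  define c where "c \<theta> z = {x \<in> carrier A. \<alpha> x (r \<theta>) = z}" for \<theta> z
  define Q where "Q \<theta> = transport (c \<theta>) (B (r \<theta>))" for \<theta>
  define J where "J = K ` I"
  define \<beta> where "\<beta> x = (\<lambda>\<theta>\<in>J. c \<theta> (\<alpha> x (r \<theta>)))" for x
  have r: "r \<theta> \<in> I" "K (r \<theta>) = \<theta>" if "\<theta> \<in> J" for \<theta>
    using that by (auto simp: r_def J_def inv_into_into f_inv_into_f)
  have c: "inj_on (c \<theta>) (carrier (B (r \<theta>)))" if "\<theta> \<in> J" for \<theta>
    unfolding onto[OF r(1)[OF that], symmetric] by (auto simp: inj_on_def c_def)
  have Q: "sig_algebra (Q \<theta>)" "carrier (Q \<theta>) = c \<theta> ` carrier (B (r \<theta>))"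
    "c \<theta> \<in> alg_hom (B (r \<theta>)) (Q \<theta>)" if "\<theta> \<in> J" for \<theta>
    using transport[OF B[OF r(1)[OF that]] c[OF that]] by (simp_all add: Q_def)
  have homQ: "(\<lambda>x. c \<theta> (\<alpha> x (r \<theta>))) \<in> alg_hom A (Q \<theta>)" if "\<theta> \<in> J" for \<theta>
    using hom[OF r(1)[OF that]] Q(3)[OF that] by (auto simp: alg_hom_def hom_def Pi_iff)
  have A: "sig_algebra A"
    using si by (simp add: subdirectly_irreducible_def)
  then interpret sig_algebra A .
  have "\<beta> \<in> alg_hom A (direct_product J Q)"
    using homQ
    by (auto simp: alg_hom_def hom_def direct_product_def \<beta>_def Pi_iff
        intro!: restrict_ext)
  moreover have "inj_on \<beta> (carrier A)"
  proof (rule inj_onI)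
    fix x y assume xy: "x \<in> carrier A" "y \<in> carrier A" "\<beta> x = \<beta> y"
    have "\<alpha> x i = \<alpha> y i" if i: "i \<in> I" for i
    proof -
      have \<theta>: "K i \<in> J" using i by (simp add: J_def)
      have "c (K i) (\<alpha> x (r (K i))) = c (K i) (\<alpha> y (r (K i)))"
        using fun_cong[OF xy(3), of "K i"] \<theta> by (simp add: \<beta>_def)
      then have "\<alpha> x (r (K i)) = \<alpha> y (r (K i))"
        using xy by (auto simp: c_def)
      then have "(x, y) \<in> K (r (K i))"
        using xy by (simp add: K_def)
      then have "(x, y) \<in> K i"
        by (simp only: r(2)[OF \<theta>])
      then show ?thesis
        by (simp add: K_def)
    qed
    moreover have "\<alpha> x \<in> extensional I" "\<alpha> y \<in> extensional I"
      using \<alpha> xy by (auto simp: embedding_def alg_hom_def hom_def direct_product_def PiE_iff Pi_iff)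
    ultimately have "\<alpha> x = \<alpha> y"
      by (auto intro: extensionalityI)
    then show "x = y"
      using \<alpha> xy by (auto simp: embedding_def inj_on_def)
  qed
  moreover have "(\<lambda>x. \<beta> x \<theta>) ` carrier A = carrier (Q \<theta>)" if "\<theta> \<in> J" for \<theta>
    using that by (simp add: \<beta>_def Q(2) onto[OF r(1)[OF that], symmetric] image_image)
  ultimately have "subdirect_embedding A J Q \<beta>"
    by (simp add: subdirect_embedding_def embedding_def Q(1))
  moreover have "J \<noteq> {}"
    using \<open>I \<noteq> {}\<close> by (simp add: J_def)
  ultimately obtain \<theta> where \<theta>: "\<theta> \<in> J" and iso: "(\<lambda>x. \<beta> x \<theta>) \<in> alg_iso A (Q \<theta>)"
    using si unfolding subdirectly_irreducible_def by blast
  have "inj_on (\<lambda>x. \<alpha> x (r \<theta>)) (carrier A)"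
  proof (rule inj_onI)
    fix x y assume xy: "x \<in> carrier A" "y \<in> carrier A" "\<alpha> x (r \<theta>) = \<alpha> y (r \<theta>)"
    then have "\<beta> x \<theta> = \<beta> y \<theta>"
      using \<theta> by (simp add: \<beta>_def)
    then show "x = y"
      using iso xy by (auto simp: alg_iso_def bij_betw_def inj_on_def)
  qed
  then have "(\<lambda>x. \<alpha> x (r \<theta>)) \<in> alg_iso A (B (r \<theta>))"
    using hom onto r(1)[OF \<theta>] by (simp add: alg_iso_def bij_betw_def)
  then show ?thesis
    using r(1)[OF \<theta>] by blast
qed

section \<open>The two completeness properties\<close>

text \<open>The carriers are subsets of a type given as an argument. As the language is countable, any
  infinite type yields the same property: take the countable subalgebra generated by valuations
  refuting the unprovable formulas and, in the subdirectly irreducible case, by an element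
  \<open>e < \<one>\<close> of the least nontrivial filter.\<close>

definition single_chain_complete :: "'a itself \<Rightarrow> fm set \<Rightarrow> bool" where
  "single_chain_complete _ L \<longleftrightarrow>
     (\<exists>A :: 'a mtl_struct. L_chain L A \<and> complete_wrt L A)"

definition subdirect_single_chain_complete :: "'a itself \<Rightarrow> fm set \<Rightarrow> bool" where
  "subdirect_single_chain_complete _ L \<longleftrightarrow>
     (\<exists>A :: 'a mtl_struct. L_algebra L A \<and> subdirectly_irreducible A \<and> generic L A)"

end

theory Submission
  imports Defs
begin

text \<open>For (2) implies (1): if a subdirectly irreducible MTL-algebra had incomparable elements
  \<open>x\<close>, \<open>y\<close>, then \<open>x \<leadsto> y\<close> and \<open>y \<leadsto> x\<close> would lie in two nontrivial filters intersecting in \<open>{\<one>}\<close>,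
  the polar of \<open>y \<leadsto> x\<close> and its double polar; so it is a chain, and by the Lindenbaum algebra a
  generic algebra is complete.

  For (1) implies (2): let the chain \<open>A\<close> be complete, with values \<open>a\<^sub>0, a\<^sub>1, \<dots>\<close> below \<open>\<one>\<close> refuting
  the unprovable formulas. In the power of \<open>A\<close> over the naturals put \<open>c\<^sub>k = max(a\<^sub>0, \<dots>, a\<^sub>k)\<close> and
  take a filter maximal among those that contain all sequences eventually equal to \<open>\<one>\<close> but not \<open>c\<close>.
  In the quotient \<open>c\<close> generates the least nontrivial filter, and it dominates every constant
  sequence \<open>a\<^sub>i\<close>, so all unprovable formulas remain refuted. A countable subalgebra containing \<open>c\<close>
  and the refuting valuations is still subdirectly irreducible and fits into any infinite type.\<close>

section \<open>Residuated lattices\<close>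

context mtl_algebra
begin

declare sig_algebra_axioms [simp]
  one_in [simp] zero_in [simp] mult_in [simp] resid_in [simp] inf_in [simp] sup_in [simp]

abbreviation le (infix \<open>\<sqsubseteq>\<close> 50) where "x \<sqsubseteq> y \<equiv> alg_le A x y"

lemma le_refl [simp]: "x \<in> carrier A \<Longrightarrow> x \<sqsubseteq> x"
  by (metis alg_le_def inf_in inf_sup_absorb sup_inf_absorb)

lemma le_antisym:
  "\<lbrakk>x \<sqsubseteq> y; y \<sqsubseteq> x; x \<in> carrier A; y \<in> carrier A\<rbrakk> \<Longrightarrow> x = y"
  by (metis alg_le_def inf_commute)

lemma le_trans:
  "\<lbrakk>x \<sqsubseteq> y; y \<sqsubseteq> z; x \<in> carrier A; y \<in> carrier A; z \<in> carrier A\<rbrakk> \<Longrightarrow> x \<sqsubseteq> z"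
  by (metis alg_le_def inf_assoc)

lemma inf_le1: "\<lbrakk>x \<in> carrier A; y \<in> carrier A\<rbrakk> \<Longrightarrow> x \<curlywedge> y \<sqsubseteq> x"
  by (metis alg_le_def inf_assoc inf_commute le_refl inf_in)

lemma inf_le2: "\<lbrakk>x \<in> carrier A; y \<in> carrier A\<rbrakk> \<Longrightarrow> x \<curlywedge> y \<sqsubseteq> y"
  by (metis inf_commute inf_le1)

lemma le_infI:
  "\<lbrakk>z \<sqsubseteq> x; z \<sqsubseteq> y; x \<in> carrier A; y \<in> carrier A; z \<in> carrier A\<rbrakk> \<Longrightarrow> z \<sqsubseteq> x \<curlywedge> y"
  by (metis alg_le_def inf_assoc)

lemma le_iff_sup: "\<lbrakk>x \<in> carrier A; y \<in> carrier A\<rbrakk> \<Longrightarrow> x \<sqsubseteq> y \<longleftrightarrow> x \<curlyvee> y = y"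
  by (metis alg_le_def inf_commute inf_sup_absorb sup_commute sup_inf_absorb)

lemma sup_ge1: "\<lbrakk>x \<in> carrier A; y \<in> carrier A\<rbrakk> \<Longrightarrow> x \<sqsubseteq> x \<curlyvee> y"
  by (simp add: alg_le_def inf_sup_absorb)

lemma sup_ge2: "\<lbrakk>x \<in> carrier A; y \<in> carrier A\<rbrakk> \<Longrightarrow> y \<sqsubseteq> x \<curlyvee> y"
  by (metis sup_commute sup_ge1)

lemma sup_leI:
  "\<lbrakk>x \<sqsubseteq> z; y \<sqsubseteq> z; x \<in> carrier A; y \<in> carrier A; z \<in> carrier A\<rbrakk> \<Longrightarrow> x \<curlyvee> y \<sqsubseteq> z"
  by (metis le_iff_sup sup_assoc sup_in)

lemma one_le_iff [simp]: "x \<in> carrier A \<Longrightarrow> \<one> \<sqsubseteq> x \<longleftrightarrow> x = \<one>"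
  using le_antisym le_one one_in le_refl by metis

lemma one_sup [simp]: "x \<in> carrier A \<Longrightarrow> \<one> \<curlyvee> x = \<one>"
  by (metis le_antisym le_one one_in sup_ge1 sup_in)

section \<open>Residuation, monotonicity and distribution over joins\<close>

lemma resid_eq_one: "\<lbrakk>x \<in> carrier A; y \<in> carrier A\<rbrakk> \<Longrightarrow> x \<leadsto> y = \<one> \<longleftrightarrow> x \<sqsubseteq> y"
  using residuation[of x y \<one>] by simp

lemma mult_mono_left:
  assumes "x \<sqsubseteq> y" "x \<in> carrier A" "y \<in> carrier A" "z \<in> carrier A"
  shows "x \<otimes> z \<sqsubseteq> y \<otimes> z"
proof -
  have "y \<sqsubseteq> z \<leadsto> (y \<otimes> z)"
    using assms residuation[of z "y \<otimes> z" y] by simp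
  with assms have "x \<sqsubseteq> z \<leadsto> (y \<otimes> z)"
    using le_trans[of x y] by simp
  then show ?thesis
    using assms by (simp add: residuation)
qed

lemma mult_mono_right:
  "\<lbrakk>x \<sqsubseteq> y; x \<in> carrier A; y \<in> carrier A; z \<in> carrier A\<rbrakk> \<Longrightarrow> z \<otimes> x \<sqsubseteq> z \<otimes> y"
  by (metis m_comm mult_mono_left)

lemma mult_mono:
  "\<lbrakk>x \<sqsubseteq> x'; y \<sqsubseteq> y'; x \<in> carrier A; x' \<in> carrier A; y \<in> carrier A; y' \<in> carrier A\<rbrakk>
    \<Longrightarrow> x \<otimes> y \<sqsubseteq> x' \<otimes> y'"
  by (meson le_trans mult_in mult_mono_left mult_mono_right)

lemma mult_le1: "\<lbrakk>x \<in> carrier A; y \<in> carrier A\<rbrakk> \<Longrightarrow> x \<otimes> y \<sqsubseteq> x"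
  using mult_mono_right[of y \<one> x] le_one by simp

lemma mult_le2: "\<lbrakk>x \<in> carrier A; y \<in> carrier A\<rbrakk> \<Longrightarrow> x \<otimes> y \<sqsubseteq> y"
  by (metis m_comm mult_le1)

lemma resid_mult_le: "\<lbrakk>x \<in> carrier A; y \<in> carrier A\<rbrakk> \<Longrightarrow> (x \<leadsto> y) \<otimes> x \<sqsubseteq> y"
  by (simp add: residuation)

text \<open>Multiplication by \<open>z\<close> has a residual and so preserves joins: both
  \<open>x\<close> and \<open>y\<close> lie below \<open>z \<leadsto> u\<close>, hence so does their
  join. Case splits over a join equal to \<open>\<one>\<close> use the bound in this form.\<close>

lemma mult_sup_leI:
  assumes "z \<otimes> x \<sqsubseteq> u" "z \<otimes> y \<sqsubseteq> u"
    and [simp]: "x \<in> carrier A" "y \<in> carrier A" "z \<in> carrier A" "u \<in> carrier A"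
  shows "z \<otimes> (x \<curlyvee> y) \<sqsubseteq> u"
proof -
  have "x \<curlyvee> y \<sqsubseteq> z \<leadsto> u"
    using assms by (intro sup_leI) (simp_all add: residuation[symmetric] m_comm)
  then show ?thesis
    by (simp add: residuation[symmetric] m_comm)
qed

text \<open>Replacing \<open>\<one>\<close> first by \<open>x \<curlyvee> z\<close> and then by
  \<open>x \<curlyvee> y\<close> leaves products that are either below \<open>x\<close> or equal to
  \<open>y \<otimes> z\<close>. This makes polars closed under multiplication.\<close>

lemma sup_mult_eq_one:
  assumes "x \<curlyvee> y = \<one>" "x \<curlyvee> z = \<one>"
    and [simp]: "x \<in> carrier A" "y \<in> carrier A" "z \<in> carrier A"
  shows "x \<curlyvee> (y \<otimes> z) = \<one>"
proof -
  let ?u = "x \<curlyvee> (y \<otimes> z)"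
  have x: "w \<otimes> x \<sqsubseteq> ?u" if [simp]: "w \<in> carrier A" for w
    using le_trans[of "w \<otimes> x" x ?u] by (simp add: mult_le2 sup_ge1)
  have "y \<otimes> (x \<curlyvee> z) \<sqsubseteq> ?u"
    by (rule mult_sup_leI) (simp_all add: x sup_ge2)
  then have "\<one> \<otimes> (x \<curlyvee> y) \<sqsubseteq> ?u"
    using x[of \<one>] assms by (intro mult_sup_leI) simp_all
  then show ?thesis
    using assms by simp
qed

text \<open>Joins are definable from meet and residuum, so formulas can express all terms of the
  signature. For the upper bound, multiply the right-hand side by \<open>\<one>\<close>, written as
  the join of \<open>x \<leadsto> y\<close> and \<open>y \<leadsto> x\<close>; each half brings it
  below \<open>y\<close> or below \<open>x\<close>.\<close>

lemma sup_eq_inf_resid: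
  assumes [simp]: "x \<in> carrier A" "y \<in> carrier A"
  shows "x \<curlyvee> y = ((x \<leadsto> y) \<leadsto> y) \<curlywedge> ((y \<leadsto> x) \<leadsto> x)" (is "_ = ?u")
proof (rule le_antisym)
  have *: "a \<sqsubseteq> (a \<leadsto> b) \<leadsto> b" "b \<sqsubseteq> (a \<leadsto> b) \<leadsto> b" if "a \<in> carrier A" "b \<in> carrier A" for a b
    using that by (simp_all add: residuation[symmetric] mult_le1 resid_mult_le m_comm[of a])
  show "x \<curlyvee> y \<sqsubseteq> ?u"
    by (intro sup_leI le_infI) (simp_all add: *)
  have "?u \<otimes> ((x \<leadsto> y) \<curlyvee> (y \<leadsto> x)) \<sqsubseteq> x \<curlyvee> y"
  proof (rule mult_sup_leI)
    have "?u \<otimes> (x \<leadsto> y) \<sqsubseteq> y"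
      by (simp add: residuation inf_le1)
    then show "?u \<otimes> (x \<leadsto> y) \<sqsubseteq> x \<curlyvee> y"
      by (rule le_trans) (simp_all add: sup_ge2)
    have "?u \<otimes> (y \<leadsto> x) \<sqsubseteq> x"
      by (simp add: residuation inf_le2)
    then show "?u \<otimes> (y \<leadsto> x) \<sqsubseteq> x \<curlyvee> y"
      by (rule le_trans) (simp_all add: sup_ge1)
  qed simp_all
  then show "?u \<sqsubseteq> x \<curlyvee> y"
    by (simp add: prelinearity)
qed simp_all

end

section \<open>Filters and quotients\<close>

context mtl_algebra
begin

text \<open>Closure is required under the product and not just under the meet, so these are the
  classes of \<open>\<one>\<close> under congruences.\<close>

definition is_filter :: "'a set \<Rightarrow> bool" where
  "is_filter F \<longleftrightarrow> F \<subseteq> carrier A \<and> \<one> \<in> F \<and> (\<forall>x\<in>F. \<forall>y\<in>F. x \<otimes> y \<in> F) \<and>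
     (\<forall>x\<in>F. \<forall>y\<in>carrier A. x \<sqsubseteq> y \<longrightarrow> y \<in> F)"

text \<open>The order modulo \<open>F\<close>. Compared with \<open>x \<leadsto> y \<in> F\<close>,
  which is equivalent for filters, the form with a multiplier eases compatibility proofs: the
  multipliers of two hypotheses are multiplied.\<close>

definition fle :: "'a set \<Rightarrow> 'a \<Rightarrow> 'a \<Rightarrow> bool" where
  "fle F x y \<longleftrightarrow> (\<exists>f\<in>F. f \<otimes> x \<sqsubseteq> y)"

definition fclass :: "'a set \<Rightarrow> 'a \<Rightarrow> 'a set" where
  "fclass F x = {y \<in> carrier A. fle F x y \<and> fle F y x}"

abbreviation quotient :: "'a set \<Rightarrow> 'a set mtl_struct" where
  "quotient F \<equiv> transport (fclass F) A"

end

locale mtl_filter = mtl_algebra +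
  fixes F
  assumes filter: "is_filter F"
begin

lemma F_in [simp]: "f \<in> F \<Longrightarrow> f \<in> carrier A"
  and F_one [simp]: "\<one> \<in> F"
  and F_mult [simp]: "\<lbrakk>f \<in> F; g \<in> F\<rbrakk> \<Longrightarrow> f \<otimes> g \<in> F"
  and F_up: "\<lbrakk>f \<in> F; f \<sqsubseteq> x; x \<in> carrier A\<rbrakk> \<Longrightarrow> x \<in> F"
  using filter by (auto simp: is_filter_def)

section \<open>The preorder modulo a filter and its classes\<close>

lemma fle_iff: "\<lbrakk>x \<in> carrier A; y \<in> carrier A\<rbrakk> \<Longrightarrow> fle F x y \<longleftrightarrow> x \<leadsto> y \<in> F"
  unfolding fle_def by (metis F_in F_up resid_in resid_mult_le residuation)

lemma le_imp_fle: "\<lbrakk>x \<sqsubseteq> y; x \<in> carrier A; y \<in> carrier A\<rbrakk> \<Longrightarrow> fle F x y"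
  by (simp add: fle_iff resid_eq_one[THEN iffD2])

lemma fle_trans:
  assumes "fle F x y" "fle F y z" and [simp]: "x \<in> carrier A" "y \<in> carrier A" "z \<in> carrier A"
  shows "fle F x z"
proof -
  obtain f g where [simp]: "f \<in> F" "g \<in> F" and fg: "f \<otimes> x \<sqsubseteq> y" "g \<otimes> y \<sqsubseteq> z"
    using assms by (auto simp: fle_def)
  have "(g \<otimes> f) \<otimes> x \<sqsubseteq> g \<otimes> y"
    using fg by (simp add: m_assoc mult_mono_right)
  then have "(g \<otimes> f) \<otimes> x \<sqsubseteq> z"
    using fg(2) by (rule le_trans) simp_all
  then show ?thesis
    unfolding fle_def by (metis F_mult \<open>f \<in> F\<close> \<open>g \<in> F\<close>)
qed

lemma fle_one_left: "x \<in> carrier A \<Longrightarrow> fle F \<one> x \<longleftrightarrow> x \<in> F"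
  unfolding fle_def by (metis F_in F_up le_refl r_one)

lemma fclass_eq_iff:
  "\<lbrakk>x \<in> carrier A; y \<in> carrier A\<rbrakk> \<Longrightarrow> fclass F x = fclass F y \<longleftrightarrow> fle F x y \<and> fle F y x"
proof
  assume "x \<in> carrier A" "y \<in> carrier A" "fclass F x = fclass F y"
  then have "y \<in> fclass F x"
    by (simp add: fclass_def le_imp_fle)
  then show "fle F x y \<and> fle F y x"
    by (simp add: fclass_def)
qed (auto simp: fclass_def intro: fle_trans)

lemma fclass_eq_one: "x \<in> carrier A \<Longrightarrow> fclass F x = fclass F \<one> \<longleftrightarrow> x \<in> F"
  by (simp add: fclass_eq_iff fle_one_left le_imp_fle le_one)

section \<open>Compatibility of the preorder with the operations\<close>

context
  fixes x x' y y'
  assumes in_A [simp]: "x \<in> carrier A" "x' \<in> carrier A" "y \<in> carrier A" "y' \<in> carrier A"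
begin

lemma fle_mult:
  assumes "fle F x x'" "fle F y y'"
  shows "fle F (x \<otimes> y) (x' \<otimes> y')"
proof -
  obtain f g where fg [simp]: "f \<in> F" "g \<in> F" "f \<otimes> x \<sqsubseteq> x'" "g \<otimes> y \<sqsubseteq> y'"
    using assms by (auto simp: fle_def)
  have "(f \<otimes> g) \<otimes> (x \<otimes> y) = (f \<otimes> x) \<otimes> (g \<otimes> y)"
    by (simp add: m_ac)
  also have "\<dots> \<sqsubseteq> x' \<otimes> y'"
    by (rule mult_mono) simp_all
  finally show ?thesis
    unfolding fle_def by (metis F_mult fg(1,2))
qed

lemma fle_inf:
  assumes "fle F x x'" "fle F y y'"
  shows "fle F (x \<curlywedge> y) (x' \<curlywedge> y')"
proof -
  obtain f g where fg [simp]: "f \<in> F" "g \<in> F" "f \<otimes> x \<sqsubseteq> x'" "g \<otimes> y \<sqsubseteq> y'"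
    using assms by (auto simp: fle_def)
  have "(f \<otimes> g) \<otimes> (x \<curlywedge> y) \<sqsubseteq> f \<otimes> x" "(f \<otimes> g) \<otimes> (x \<curlywedge> y) \<sqsubseteq> g \<otimes> y"
    by (auto intro!: mult_mono simp: mult_le1 mult_le2 inf_le1 inf_le2)
  then have "(f \<otimes> g) \<otimes> (x \<curlywedge> y) \<sqsubseteq> x' \<curlywedge> y'"
    by (intro le_infI) (auto intro: le_trans)
  then show ?thesis
    unfolding fle_def by (metis F_mult fg(1,2))
qed

lemma fle_sup:
  assumes "fle F x x'" "fle F y y'"
  shows "fle F (x \<curlyvee> y) (x' \<curlyvee> y')"
proof -
  obtain f g where fg [simp]: "f \<in> F" "g \<in> F" "f \<otimes> x \<sqsubseteq> x'" "g \<otimes> y \<sqsubseteq> y'"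
    using assms by (auto simp: fle_def)
  have "(f \<otimes> g) \<otimes> x \<sqsubseteq> f \<otimes> x" "(f \<otimes> g) \<otimes> y \<sqsubseteq> g \<otimes> y"
    by (auto intro!: mult_mono_left simp: mult_le1 mult_le2)
  then have "(f \<otimes> g) \<otimes> x \<sqsubseteq> x'" "(f \<otimes> g) \<otimes> y \<sqsubseteq> y'"
    by (auto intro: le_trans)
  then have "(f \<otimes> g) \<otimes> (x \<curlyvee> y) \<sqsubseteq> x' \<curlyvee> y'"
    by (intro mult_sup_leI) (auto intro: le_trans[OF _ sup_ge1] le_trans[OF _ sup_ge2])
  then show ?thesis
    unfolding fle_def by (metis F_mult fg(1,2))
qed

lemma fle_resid:
  assumes "fle F x' x" "fle F y y'"
  shows "fle F (x \<leadsto> y) (x' \<leadsto> y')"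
proof -
  obtain f g where fg [simp]: "f \<in> F" "g \<in> F" "f \<otimes> x' \<sqsubseteq> x" "g \<otimes> y \<sqsubseteq> y'"
    using assms by (auto simp: fle_def)
  have "(f \<otimes> g) \<otimes> (x \<leadsto> y) \<otimes> x' = g \<otimes> ((x \<leadsto> y) \<otimes> (f \<otimes> x'))"
    by (simp add: m_ac)
  also have "\<dots> \<sqsubseteq> g \<otimes> ((x \<leadsto> y) \<otimes> x)"
    by (intro mult_mono_right) simp_all
  finally have "(f \<otimes> g) \<otimes> (x \<leadsto> y) \<otimes> x' \<sqsubseteq> g \<otimes> ((x \<leadsto> y) \<otimes> x)" .
  then have "(f \<otimes> g) \<otimes> (x \<leadsto> y) \<otimes> x' \<sqsubseteq> g \<otimes> y"
    by (rule le_trans) (simp_all add: mult_mono_right resid_mult_le)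
  then have "(f \<otimes> g) \<otimes> (x \<leadsto> y) \<otimes> x' \<sqsubseteq> y'"
    by (rule le_trans) simp_all
  then have "(f \<otimes> g) \<otimes> (x \<leadsto> y) \<sqsubseteq> x' \<leadsto> y'"
    by (simp add: residuation)
  then show ?thesis
    unfolding fle_def by (metis F_mult fg(1,2))
qed

end

end

text \<open>\<open>transport\<close> computes on representatives chosen by \<open>inv_into\<close>.
  If the kernel of \<open>f\<close> is a congruence, the choice does not matter and the result is
  the quotient by that kernel, even when \<open>f\<close> is not injective. Both the quotients by
  filters and the Lindenbaum algebra arise this way.\<close>

lemma transport_kernel:
  assumes "sig_algebra A"
    and "\<And>x x' y y'. \<lbrakk>x \<in> carrier A; x' \<in> carrier A; y \<in> carrier A; y' \<in> carrier A;
           f x = f x'; f y = f y'\<rbrakk> \<Longrightarrow>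
           f (x \<otimes>\<^bsub>A\<^esub> y) = f (x' \<otimes>\<^bsub>A\<^esub> y') \<and> f (x \<leadsto>\<^bsub>A\<^esub> y) = f (x' \<leadsto>\<^bsub>A\<^esub> y') \<and>
           f (x \<curlywedge>\<^bsub>A\<^esub> y) = f (x' \<curlywedge>\<^bsub>A\<^esub> y') \<and> f (x \<curlyvee>\<^bsub>A\<^esub> y) = f (x' \<curlyvee>\<^bsub>A\<^esub> y')"
  shows "sig_algebra (transport f A)" "carrier (transport f A) = f ` carrier A"
    "f \<in> alg_hom A (transport f A)"
proof -
  interpret sig_algebra A by fact
  note [simp] = one_in zero_in mult_in resid_in inf_in sup_in
  have inv: "inv_into (carrier A) f (f x) \<in> carrier A" "f (inv_into (carrier A) f (f x)) = f x"
    if "x \<in> carrier A" for x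
    using that by (simp_all add: inv_into_into f_inv_into_f)
  show "sig_algebra (transport f A)" "carrier (transport f A) = f ` carrier A"
    by (auto simp: transport_def Let_def sig_algebra_def inv)
  have "f (inv_into (carrier A) f (f x) \<otimes>\<^bsub>A\<^esub> inv_into (carrier A) f (f y)) = f (x \<otimes>\<^bsub>A\<^esub> y)"
    "f (inv_into (carrier A) f (f x) \<leadsto>\<^bsub>A\<^esub> inv_into (carrier A) f (f y)) = f (x \<leadsto>\<^bsub>A\<^esub> y)"
    "f (inv_into (carrier A) f (f x) \<curlywedge>\<^bsub>A\<^esub> inv_into (carrier A) f (f y)) = f (x \<curlywedge>\<^bsub>A\<^esub> y)"
    "f (inv_into (carrier A) f (f x) \<curlyvee>\<^bsub>A\<^esub> inv_into (carrier A) f (f y)) = f (x \<curlyvee>\<^bsub>A\<^esub> y)"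
    if "x \<in> carrier A" "y \<in> carrier A" for x y
    using assms(2)[OF inv(1)[OF that(1)] that(1) inv(1)[OF that(2)] that(2)
        inv(2)[OF that(1)] inv(2)[OF that(2)]] by auto
  then show "f \<in> alg_hom A (transport f A)"
    by (auto simp: transport_def Let_def alg_hom_def hom_def)
qed

lemma (in mtl_filter) quotient:
  shows sig_quotient: "sig_algebra (quotient F)"
    and carrier_quotient: "carrier (quotient F) = fclass F ` carrier A"
    and hom_quotient: "fclass F \<in> alg_hom A (quotient F)"
proof (rule_tac [!] transport_kernel)
  show "sig_algebra A" "sig_algebra A" "sig_algebra A" by unfold_locales
qed (auto simp: fclass_eq_iff intro!: fle_mult fle_resid fle_inf fle_sup)

section \<open>Subdirect irreducibility\<close>

lemma alg_homD:
  assumes "h \<in> alg_hom A B"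
  shows "h \<one>\<^bsub>A\<^esub> = \<one>\<^bsub>B\<^esub>" "h \<zero>\<^bsub>A\<^esub> = \<zero>\<^bsub>B\<^esub>"
    "x \<in> carrier A \<Longrightarrow> h x \<in> carrier B"
    "\<lbrakk>x \<in> carrier A; y \<in> carrier A\<rbrakk> \<Longrightarrow> h (x \<otimes>\<^bsub>A\<^esub> y) = h x \<otimes>\<^bsub>B\<^esub> h y"
    "\<lbrakk>x \<in> carrier A; y \<in> carrier A\<rbrakk> \<Longrightarrow> h (x \<leadsto>\<^bsub>A\<^esub> y) = h x \<leadsto>\<^bsub>B\<^esub> h y"
    "\<lbrakk>x \<in> carrier A; y \<in> carrier A\<rbrakk> \<Longrightarrow> h (x \<curlywedge>\<^bsub>A\<^esub> y) = h x \<curlywedge>\<^bsub>B\<^esub> h y"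
    "\<lbrakk>x \<in> carrier A; y \<in> carrier A\<rbrakk> \<Longrightarrow> h (x \<curlyvee>\<^bsub>A\<^esub> y) = h x \<curlyvee>\<^bsub>B\<^esub> h y"
  using assms by (auto simp: alg_hom_def hom_def)

lemma subdirect_embeddingD:
  assumes "subdirect_embedding A I B \<alpha>"
  shows "i \<in> I \<Longrightarrow> (\<lambda>x. \<alpha> x i) \<in> alg_hom A (B i)"
    "i \<in> I \<Longrightarrow> inj_on (\<lambda>x. \<alpha> x i) (carrier A) \<Longrightarrow> (\<lambda>x. \<alpha> x i) \<in> alg_iso A (B i)"
    "\<lbrakk>x \<in> carrier A; y \<in> carrier A; \<And>i. i \<in> I \<Longrightarrow> \<alpha> x i = \<alpha> y i\<rbrakk> \<Longrightarrow> x = y"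
proof -
  have \<alpha>: "\<alpha> \<in> embedding A (direct_product I B)"
    using assms by (simp add: subdirect_embedding_def)
  show hom: "(\<lambda>x. \<alpha> x i) \<in> alg_hom A (B i)" if "i \<in> I" for i
    using \<alpha> that
    by (auto simp: embedding_def alg_hom_def hom_def direct_product_def PiE_iff Pi_iff)
  show "(\<lambda>x. \<alpha> x i) \<in> alg_iso A (B i)" if "i \<in> I" "inj_on (\<lambda>x. \<alpha> x i) (carrier A)"
    using hom that assms by (simp add: alg_iso_def bij_betw_def subdirect_embedding_def)
  show "x = y" if xy: "x \<in> carrier A" "y \<in> carrier A" and eq: "\<And>i. i \<in> I \<Longrightarrow> \<alpha> x i = \<alpha> y i"
  proof -
    have "\<alpha> x \<in> extensional I" "\<alpha> y \<in> extensional I"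
      using \<alpha> xy by (auto simp: embedding_def alg_hom_def hom_def direct_product_def PiE_iff Pi_iff)
    then have "\<alpha> x = \<alpha> y"
      using eq by (auto intro: extensionalityI)
    then show ?thesis
      using \<alpha> xy by (auto simp: embedding_def inj_on_def)
  qed
qed

context mtl_algebra
begin

lemma hom_pow_eq_one:
  assumes h: "h \<in> alg_hom A B" and x [simp]: "x \<in> carrier A" and hx: "h x = h \<one>"
  shows "h (x [^] (m::nat)) = h \<one>"
proof (induction m)
  case (Suc m)
  have "h (x [^] Suc m) = h (x [^] m) \<otimes>\<^bsub>B\<^esub> h x"
    by (simp add: alg_homD[OF h])
  also have "\<dots> = h (\<one> \<otimes> \<one>)"
    using Suc hx alg_homD(4)[OF h one_in one_in] by simp
  finally show ?case by simp
qed simp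

text \<open>The element \<open>c\<close> generates the least nontrivial filter. A projection that is
  not injective sends some element other than \<open>\<one>\<close> to the image of
  \<open>\<one>\<close>, hence also its powers and the larger element \<open>c\<close>. If this
  happened at every index, \<open>c\<close> and \<open>\<one>\<close> would agree in all
  coordinates.\<close>

lemma subdirectly_irreducible_if_monolith:
  assumes c [simp]: "c \<in> carrier A" and c1: "c \<noteq> \<one>"
    and mono: "\<And>x. \<lbrakk>x \<in> carrier A; x \<noteq> \<one>\<rbrakk> \<Longrightarrow> \<exists>m::nat. x [^] m \<sqsubseteq> c"
  shows "subdirectly_irreducible A"
  unfolding subdirectly_irreducible_def
proof (intro conjI allI impI)
  show "sig_algebra A" by unfold_locales
next
  fix I and B :: "_ \<Rightarrow> 'a set mtl_struct" and \<alpha>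
  assume "I \<noteq> {} \<and> subdirect_embedding A I B \<alpha>"
  then have sub: "subdirect_embedding A I B \<alpha>" by simp
  show "\<exists>i\<in>I. (\<lambda>x. \<alpha> x i) \<in> alg_iso A (B i)"
  proof (rule ccontr)
    assume *: "\<not> (\<exists>i\<in>I. (\<lambda>x. \<alpha> x i) \<in> alg_iso A (B i))"
    have "\<alpha> c i = \<alpha> \<one> i" if i: "i \<in> I" for i
    proof -
      let ?h = "\<lambda>x. \<alpha> x i"
      note h = subdirect_embeddingD(1)[OF sub i]
      have "\<not> inj_on ?h (carrier A)"
        using * subdirect_embeddingD(2)[OF sub i] i by blast
      then obtain x y where [simp]: "x \<in> carrier A" "y \<in> carrier A" and "x \<noteq> y" "?h x = ?h y"
        by (auto simp: inj_on_def)
      \<comment> \<open>By antisymmetry one of the two inequalities between distinct elements fails;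
        the names are exchanged if necessary.\<close>
      then obtain x y where [simp]: "x \<in> carrier A" "y \<in> carrier A"
        and xy: "\<not> x \<sqsubseteq> y" "?h x = ?h y"
        using le_antisym by metis
      have "?h (x \<leadsto> y) = ?h (x \<leadsto> x)"
        using xy by (simp add: alg_homD(5)[OF h])
      then have "?h (x \<leadsto> y) = ?h \<one>"
        by (simp add: resid_eq_one[THEN iffD2])
      moreover obtain m :: nat where m: "(x \<leadsto> y) [^] m \<sqsubseteq> c"
        using mono[of "x \<leadsto> y"] xy by (auto simp: resid_eq_one)
      ultimately have "?h ((x \<leadsto> y) [^] m) = ?h \<one>"
        using hom_pow_eq_one[OF h] by simp
      \<comment> \<open>Joining with \<open>c\<close> turns the left argument into \<open>c\<close>,
        which is above the power, and the right one into \<open>\<one>\<close>.\<close>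
      then have "?h ((x \<leadsto> y) [^] m \<curlyvee> c) = ?h (\<one> \<curlyvee> c)"
        by (simp add: alg_homD(7)[OF h] del: one_sup)
      then show ?thesis
        using m by (simp add: le_iff_sup)
    qed
    then show False
      using c1 subdirect_embeddingD(3)[OF sub, of c \<one>] by simp
  qed
qed

text \<open>The carrier has one element, so every projection is injective, and a nonempty family
  supplies an index. This serves the inconsistent logic.\<close>

lemma subdirectly_irreducible_trivial:
  assumes "\<zero> = \<one>"
  shows "subdirectly_irreducible A"
proof -
  have "x = y" if "x \<in> carrier A" "y \<in> carrier A" for x y
    using that assms zero_le by (metis one_le_iff)
  then have inj: "inj_on f (carrier A)" for f :: "'a \<Rightarrow> 'a set"
    by (auto simp: inj_on_def)
  have "sig_algebra A" by unfold_locales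
  moreover have "(\<lambda>x. \<alpha> x i) \<in> alg_iso A (B i)"
    if "subdirect_embedding A I B \<alpha>" "i \<in> I"
    for I :: "('a \<times> 'a) set set" and B :: "_ \<Rightarrow> 'a set mtl_struct" and \<alpha> i
    using subdirect_embeddingD(2)[OF that inj] .
  ultimately show ?thesis
    unfolding subdirectly_irreducible_def by blast
qed

section \<open>Polars and linearity of subdirectly irreducible algebras\<close>

definition polar :: "'a set \<Rightarrow> 'a set" where
  "polar S = {x \<in> carrier A. \<forall>s\<in>S. s \<curlyvee> x = \<one>}"

text \<open>Here two elements are orthogonal when their join is \<open>\<one>\<close>. Closure of
  the orthogonal complement under products is \<open>sup_mult_eq_one\<close>; upward closure is
  associativity of the join.\<close>

lemma polar_filter:
  assumes "S \<subseteq> carrier A"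
  shows "is_filter (polar S)"
proof -
  have S: "s \<in> S \<Longrightarrow> s \<in> carrier A" for s
    using assms by blast
  have "s \<curlyvee> y = \<one>" if "s \<curlyvee> x = \<one>" "x \<sqsubseteq> y" "s \<in> S" "x \<in> carrier A" "y \<in> carrier A" for s x y
    using that S le_iff_sup[of x y] sup_assoc[of s x y] by simp
  then show ?thesis
    using S by (auto simp: is_filter_def polar_def sup_mult_eq_one sup_commute[of _ \<one>])
qed

text \<open>The quotients by the polar of \<open>b\<close> and by its double polar form a subdirect
  representation, so one of the two filters is trivial. The first contains \<open>a\<close>, the
  second contains \<open>b\<close>.\<close>

lemma subdirectly_irreducible_imp_prime:
  assumes si: "subdirectly_irreducible A"
    and ab: "a \<curlyvee> b = \<one>" and [simp]: "a \<in> carrier A" "b \<in> carrier A"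
  shows "a = \<one> \<or> b = \<one>"
proof -
  define P where "P i = (if i then polar {b} else polar (polar {b}))" for i
  have P: "mtl_filter A (P i)" for i
  proof
    have "polar {b} \<subseteq> carrier A"
      by (auto simp: polar_def)
    then show "is_filter (P i)"
      by (simp add: P_def polar_filter)
  qed
  define \<alpha> where "\<alpha> x = (\<lambda>i. fclass (P i) x)" for x
  have hom: "fclass (P i) \<in> alg_hom A (quotient (P i))" for i
    by (rule mtl_filter.hom_quotient[OF P])
  \<comment> \<open>An element of both a polar and its own polar is orthogonal to itself, so
    \<open>x \<curlyvee> x = \<one>\<close>.\<close>
  have P_one: "x = \<one>" if "\<And>i. x \<in> P i" for x
    using that[of True] that[of False] le_refl[of x] le_iff_sup[of x x] by (auto simp: P_def polar_def)
  have inj: "x \<sqsubseteq> y" if "x \<in> carrier A" "y \<in> carrier A" "\<alpha> x = \<alpha> y" for x y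
  proof -
    have "x \<leadsto> y \<in> P i" for i
      using fun_cong[OF that(3), of i] that(1,2)
      by (simp add: \<alpha>_def mtl_filter.fclass_eq_iff[OF P] mtl_filter.fle_iff[OF P])
    then show ?thesis
      using that P_one by (simp add: resid_eq_one[symmetric])
  qed
  have "inj_on \<alpha> (carrier A)"
    by (rule inj_onI) (metis le_antisym inj)
  moreover have "\<alpha> \<in> alg_hom A (direct_product UNIV (\<lambda>i. quotient (P i)))"
    using hom by (auto simp: alg_hom_def hom_def direct_product_def \<alpha>_def Pi_iff)
  ultimately have "subdirect_embedding A UNIV (\<lambda>i. quotient (P i)) \<alpha>"
    unfolding subdirect_embedding_def embedding_def
    by (auto simp: \<alpha>_def mtl_filter.quotient(1,2)[OF P])
  \<comment> \<open>The index type is \<open>bool\<close>, hence the form of irreducibility for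
    families of any type.\<close>
  then obtain i where "(\<lambda>x. \<alpha> x i) \<in> alg_iso A (quotient (P i))"
    using subdirectly_irreducible_any_family[OF si] by blast
  then have "inj_on (fclass (P i)) (carrier A)"
    by (simp add: alg_iso_def bij_betw_def \<alpha>_def)
  then have "x = \<one>" if "x \<in> P i" for x
    using that mtl_filter.fclass_eq_one[OF P, of x] mtl_filter.F_in[OF P that]
    by (auto dest: inj_onD)
  moreover have "a \<in> P True" "b \<in> P False"
    using ab by (auto simp: P_def polar_def sup_commute)
  ultimately show ?thesis
    by (cases i) auto
qed

text \<open>By prelinearity the residua \<open>x \<leadsto> y\<close> and
  \<open>y \<leadsto> x\<close> join to \<open>\<one>\<close>, so one of them is
  \<open>\<one>\<close>.\<close>

lemma subdirectly_irreducible_imp_chain: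
  assumes "subdirectly_irreducible A"
  shows "totally_ordered A"
  unfolding totally_ordered_def
  using subdirectly_irreducible_imp_prime[OF assms prelinearity] by (simp add: resid_eq_one)

text \<open>A filter maximal among those avoiding \<open>c\<close> has a quotient in which \<open>c\<close> generates the least
  nontrivial filter.\<close>

lemma maximal_filter_avoiding:
  assumes F0: "is_filter F0" and c [simp]: "c \<in> carrier A" and cF0: "c \<notin> F0"
  obtains F where "is_filter F" "F0 \<subseteq> F" "c \<notin> F"
    "\<And>x. \<lbrakk>x \<in> carrier A; x \<notin> F\<rbrakk> \<Longrightarrow> \<exists>m::nat. fle F (x [^] m) c"
proof -
  define \<F> where "\<F> = {F. is_filter F \<and> F0 \<subseteq> F \<and> c \<notin> F}"
  have "F0 \<in> \<F>"
    using F0 cF0 by (simp add: \<F>_def)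
  have "\<exists>F\<in>\<F>. \<forall>G\<in>\<F>. F \<subseteq> G \<longrightarrow> G = F"
  proof (rule subset_Zorn_nonempty)
    show "\<F> \<noteq> {}" using \<open>F0 \<in> \<F>\<close> by blast
    fix \<C> assume \<C>: "\<C> \<noteq> {}" "subset.chain \<F> \<C>"
    have filters: "is_filter F" "F0 \<subseteq> F" "c \<notin> F" if "F \<in> \<C>" for F
      using \<C>(2) that by (auto simp: subset_chain_def \<F>_def)
    obtain F1 where F1: "F1 \<in> \<C>"
      using \<C>(1) by blast
    have "is_filter (\<Union>\<C>)"
      unfolding is_filter_def
    proof (intro conjI ballI impI)
      show "\<Union>\<C> \<subseteq> carrier A"
        using filters(1) unfolding is_filter_def by blast
      show "\<one> \<in> \<Union>\<C>"
        using filters(1)[OF F1] F1 by (auto simp: is_filter_def)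
      fix x y assume x: "x \<in> \<Union>\<C>"
      then show "y \<in> \<Union>\<C>" if "y \<in> carrier A" "x \<sqsubseteq> y"
        using filters(1) that by (fastforce simp: is_filter_def)
      assume "y \<in> \<Union>\<C>"
      with x obtain F G where FG: "F \<in> \<C>" "G \<in> \<C>" "x \<in> F" "y \<in> G"
        by blast
      then have "F \<subseteq> G \<or> G \<subseteq> F"
        using \<C>(2) by (auto simp: subset_chain_def)
      then obtain H where H: "H \<in> \<C>" "x \<in> H" "y \<in> H"
        using FG by blast
      then have "x \<otimes> y \<in> H"
        using filters(1)[OF H(1)] by (simp add: is_filter_def)
      then show "x \<otimes> y \<in> \<Union>\<C>"
        using H(1) by blast
    qed
    moreover have "F0 \<subseteq> \<Union>\<C>" "c \<notin> \<Union>\<C>"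
      using filters(2)[OF F1] filters(3) F1 by auto
    ultimately show "\<Union>\<C> \<in> \<F>"
      by (simp add: \<F>_def)
  qed
  then obtain F where F: "F \<in> \<F>" and max: "\<And>G. \<lbrakk>G \<in> \<F>; F \<subseteq> G\<rbrakk> \<Longrightarrow> G = F"
    by blast
  then interpret mtl_filter A F
    by unfold_locales (simp add: \<F>_def)
  show thesis
  proof (rule that)
    show "is_filter F" "F0 \<subseteq> F" "c \<notin> F"
      using F by (auto simp: \<F>_def)
    fix x assume x [simp]: "x \<in> carrier A" and xF: "x \<notin> F"
    \<comment> \<open>The filter generated by \<open>F\<close> and \<open>x\<close>. It properly
      extends \<open>F\<close>, so by maximality it cannot avoid \<open>c\<close>.\<close>
    define G where "G = {y \<in> carrier A. \<exists>m::nat. fle F (x [^] m) y}"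
    have G1: "y \<in> G" if "y \<in> F" for y
      using that by (auto simp: G_def fle_one_left intro!: exI[of _ 0])
    have "x \<in> G"
      by (auto simp: G_def le_imp_fle intro!: exI[of _ "1::nat"])
    have "is_filter G"
      unfolding is_filter_def
    proof (intro conjI ballI impI)
      show "G \<subseteq> carrier A" "\<one> \<in> G"
        using G1 by (auto simp: G_def)
      fix y z assume "y \<in> G"
      then obtain m :: nat where y [simp]: "y \<in> carrier A" and m: "fle F (x [^] m) y"
        by (auto simp: G_def)
      show "z \<in> G" if "z \<in> carrier A" "y \<sqsubseteq> z"
        using fle_trans[OF m le_imp_fle] that by (auto simp: G_def)
      assume "z \<in> G"
      then obtain k :: nat where z [simp]: "z \<in> carrier A" and k: "fle F (x [^] k) z"
        by (auto simp: G_def)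
      have "fle F (x [^] (m + k)) (y \<otimes> z)"
        using fle_mult[OF _ _ _ _ m k] by (simp add: nat_pow_mult)
      then show "y \<otimes> z \<in> G"
        by (auto simp: G_def)
    qed
    then have "c \<in> G"
      using max[of G] G1 \<open>x \<in> G\<close> xF F by (auto simp: \<F>_def)
    then show "\<exists>m::nat. fle F (x [^] m) c"
      by (simp add: G_def)
  qed
qed

end

section \<open>Equations and formulas\<close>

primrec trm_of_fm :: "fm \<Rightarrow> trm" where
  "trm_of_fm (Var k) = TVar k"
| "trm_of_fm \<^bold>\<bottom> = TZero"
| "trm_of_fm (\<phi> \<^bold>& \<psi>) = TMult (trm_of_fm \<phi>) (trm_of_fm \<psi>)"
| "trm_of_fm (\<phi> \<^bold>\<and> \<psi>) = TInf (trm_of_fm \<phi>) (trm_of_fm \<psi>)"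
| "trm_of_fm (\<phi> \<^bold>\<rightarrow> \<psi>) = TResid (trm_of_fm \<phi>) (trm_of_fm \<psi>)"

lemma term_eval_trm_of_fm [simp]: "term_eval A v (trm_of_fm \<phi>) = eval A v \<phi>"
  by (induction \<phi>) auto

lemma valid_in_iff_satisfies_eq: "valid_in A \<phi> \<longleftrightarrow> satisfies_eq A (trm_of_fm \<phi>) TOne"
  by (simp add: valid_in_def satisfies_eq_def)

definition fm_top :: fm  (\<open>\<^bold>\<top>\<close>) where "\<^bold>\<top> = \<^bold>\<bottom> \<^bold>\<rightarrow> \<^bold>\<bottom>"

definition Disj :: "fm \<Rightarrow> fm \<Rightarrow> fm"  (infixr \<open>\<^bold>\<or>\<close> 65) where
  "\<phi> \<^bold>\<or> \<psi> = ((\<phi> \<^bold>\<rightarrow> \<psi>) \<^bold>\<rightarrow> \<psi>) \<^bold>\<and> ((\<psi> \<^bold>\<rightarrow> \<phi>) \<^bold>\<rightarrow> \<phi>)"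

primrec fm_of_trm :: "trm \<Rightarrow> fm" where
  "fm_of_trm (TVar k) = Var k"
| "fm_of_trm TOne = \<^bold>\<top>"
| "fm_of_trm TZero = \<^bold>\<bottom>"
| "fm_of_trm (TMult s t) = fm_of_trm s \<^bold>& fm_of_trm t"
| "fm_of_trm (TResid s t) = fm_of_trm s \<^bold>\<rightarrow> fm_of_trm t"
| "fm_of_trm (TInf s t) = fm_of_trm s \<^bold>\<and> fm_of_trm t"
| "fm_of_trm (TSup s t) = fm_of_trm s \<^bold>\<or> fm_of_trm t"

definition fm_eq :: "trm \<Rightarrow> trm \<Rightarrow> fm" where
  "fm_eq s t = (fm_of_trm s \<^bold>\<rightarrow> fm_of_trm t) \<^bold>\<and> (fm_of_trm t \<^bold>\<rightarrow> fm_of_trm s)"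

context mtl_algebra
begin

lemma eval_fm_of_trm:
  assumes v: "v \<in> UNIV \<rightarrow> carrier A"
  shows "eval A v (fm_of_trm t) = term_eval A v t"
  using v
  by (induction t)
    (auto simp: fm_top_def Disj_def resid_eq_one[THEN iffD2] sup_eq_inf_resid term_eval_in)

lemma inf_eq_one: "\<lbrakk>x \<in> carrier A; y \<in> carrier A\<rbrakk> \<Longrightarrow> x \<curlywedge> y = \<one> \<longleftrightarrow> x = \<one> \<and> y = \<one>"
  by (metis inf_le1 inf_le2 one_le_iff le_refl alg_le_def)

text \<open>Both residua being \<open>\<one>\<close> amounts to two inequalities, and antisymmetry
  gives equality. This translates every equation into a formula.\<close>

lemma satisfies_eq_iff_valid_in: "satisfies_eq A s t \<longleftrightarrow> valid_in A (fm_eq s t)"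
  unfolding satisfies_eq_def valid_in_def fm_eq_def
  by (intro ball_cong refl)
    (auto simp: eval_fm_of_trm inf_eq_one resid_eq_one term_eval_in intro: le_antisym)

end

text \<open>The formula expressing the equation is valid in \<open>A\<close>, hence provable, hence
  valid in every L-algebra, over any carrier type.\<close>

lemma satisfies_eq_if_complete:
  assumes "L_algebra L A" "complete_wrt L A" "L_algebra L C" "satisfies_eq A s t"
  shows "satisfies_eq C s t"
  using assms mtl_algebra.satisfies_eq_iff_valid_in
  unfolding L_algebra_def complete_wrt_def by metis

text \<open>Residuation, the only condition on MTL-algebras that is not an equation, is replaced by
  the two inequalities \<open>z \<sqsubseteq> x \<leadsto> ((z \<otimes> x) \<curlyvee> y)\<close> and \<open>((x \<leadsto> y) \<curlywedge> z) \<otimes> x \<sqsubseteq> y\<close>.\<close>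

lemma mtl_algebra_if_satisfies_eqs:
  assumes A: "mtl_algebra A" and C: "sig_algebra C"
    and AC: "\<And>s t. satisfies_eq A s t \<Longrightarrow> satisfies_eq C s t"
  shows "mtl_algebra C"
proof -
  interpret A: mtl_algebra A by fact
  interpret C: sig_algebra C by fact
  note [simp] = C.one_in C.zero_in C.mult_in C.resid_in C.inf_in C.sup_in
  let ?v = "\<lambda>x y z k. if k = 0 then x else if k = Suc 0 then y else z"
  let ?x = "TVar 0" and ?y = "TVar 1" and ?z = "TVar 2"
  have eq: "term_eval C (?v x y z) s = term_eval C (?v x y z) t"
    if "x \<in> carrier C" "y \<in> carrier C" "z \<in> carrier C"
      "\<And>v. (\<And>k. v k \<in> carrier A) \<Longrightarrow> term_eval A v s = term_eval A v t" for x y z s t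
    using AC[of s t] that by (auto simp: satisfies_eq_def Pi_iff)
  note [simp] = A.le_one A.zero_le A.prelinearity A.inf_sup_absorb A.sup_inf_absorb
  have comm: "x \<otimes>\<^bsub>C\<^esub> y = y \<otimes>\<^bsub>C\<^esub> x" "x \<curlywedge>\<^bsub>C\<^esub> y = y \<curlywedge>\<^bsub>C\<^esub> x" "x \<curlyvee>\<^bsub>C\<^esub> y = y \<curlyvee>\<^bsub>C\<^esub> x"
    if "x \<in> carrier C" "y \<in> carrier C" for x y
    using eq[OF that that(1), of "TMult ?x ?y" "TMult ?y ?x"]
      eq[OF that that(1), of "TInf ?x ?y" "TInf ?y ?x"]
      eq[OF that that(1), of "TSup ?x ?y" "TSup ?y ?x"]
    by (simp_all add: A.m_comm A.inf_commute A.sup_commute)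
  have assoc: "(x \<otimes>\<^bsub>C\<^esub> y) \<otimes>\<^bsub>C\<^esub> z = x \<otimes>\<^bsub>C\<^esub> (y \<otimes>\<^bsub>C\<^esub> z)"
      "(x \<curlywedge>\<^bsub>C\<^esub> y) \<curlywedge>\<^bsub>C\<^esub> z = x \<curlywedge>\<^bsub>C\<^esub> (y \<curlywedge>\<^bsub>C\<^esub> z)" "(x \<curlyvee>\<^bsub>C\<^esub> y) \<curlyvee>\<^bsub>C\<^esub> z = x \<curlyvee>\<^bsub>C\<^esub> (y \<curlyvee>\<^bsub>C\<^esub> z)"
    if "x \<in> carrier C" "y \<in> carrier C" "z \<in> carrier C" for x y z
    using eq[OF that, of "TMult (TMult ?x ?y) ?z" "TMult ?x (TMult ?y ?z)"]
      eq[OF that, of "TInf (TInf ?x ?y) ?z" "TInf ?x (TInf ?y ?z)"]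
      eq[OF that, of "TSup (TSup ?x ?y) ?z" "TSup ?x (TSup ?y ?z)"]
    by (simp_all add: A.m_assoc A.inf_assoc A.sup_assoc)
  have absorb: "x \<curlywedge>\<^bsub>C\<^esub> (x \<curlyvee>\<^bsub>C\<^esub> y) = x" "x \<curlyvee>\<^bsub>C\<^esub> (x \<curlywedge>\<^bsub>C\<^esub> y) = x"
    if "x \<in> carrier C" "y \<in> carrier C" for x y
    using eq[OF that that(1), of "TInf ?x (TSup ?x ?y)" ?x]
      eq[OF that that(1), of "TSup ?x (TInf ?x ?y)" ?x] by simp_all
  have bounds: "alg_le C \<zero>\<^bsub>C\<^esub> x" "alg_le C x \<one>\<^bsub>C\<^esub>" "\<one>\<^bsub>C\<^esub> \<otimes>\<^bsub>C\<^esub> x = x" if "x \<in> carrier C" for x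
    using eq[OF that that that, of "TInf TZero ?x" TZero] eq[OF that that that, of "TInf ?x TOne" ?x]
      eq[OF that that that, of "TMult TOne ?x" ?x]
    by (simp_all add: alg_le_def[symmetric])
  have prelin: "(x \<leadsto>\<^bsub>C\<^esub> y) \<curlyvee>\<^bsub>C\<^esub> (y \<leadsto>\<^bsub>C\<^esub> x) = \<one>\<^bsub>C\<^esub>" if "x \<in> carrier C" "y \<in> carrier C" for x y
    using eq[OF that that(1), of "TSup (TResid ?x ?y) (TResid ?y ?x)" TOne] by simp
  have res1: "alg_le C z (x \<leadsto>\<^bsub>C\<^esub> ((z \<otimes>\<^bsub>C\<^esub> x) \<curlyvee>\<^bsub>C\<^esub> y))"
    if "x \<in> carrier C" "y \<in> carrier C" "z \<in> carrier C" for x y z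
    using eq[OF that, of "TInf ?z (TResid ?x (TSup (TMult ?z ?x) ?y))" ?z]
    by (simp add: alg_le_def[symmetric] A.sup_ge1 flip: A.residuation)
  have res2: "alg_le C (((x \<leadsto>\<^bsub>C\<^esub> y) \<curlywedge>\<^bsub>C\<^esub> z) \<otimes>\<^bsub>C\<^esub> x) y"
    if "x \<in> carrier C" "y \<in> carrier C" "z \<in> carrier C" for x y z
    using eq[OF that, of "TInf (TMult (TInf (TResid ?x ?y) ?z) ?x) ?y" "TMult (TInf (TResid ?x ?y) ?z) ?x"]
    by (simp add: alg_le_def[symmetric] A.residuation A.inf_le1)
  have residuation: "alg_le C (z \<otimes>\<^bsub>C\<^esub> x) y \<longleftrightarrow> alg_le C z (x \<leadsto>\<^bsub>C\<^esub> y)"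
    if [simp]: "x \<in> carrier C" "y \<in> carrier C" "z \<in> carrier C" for x y z
  proof
    assume "alg_le C (z \<otimes>\<^bsub>C\<^esub> x) y"
    \<comment> \<open>Once the join collapses to \<open>y\<close>, the first inequality is the
      claim; in the converse direction the meet in the second one collapses to
      \<open>z\<close>.\<close>
    then have "(z \<otimes>\<^bsub>C\<^esub> x) \<curlyvee>\<^bsub>C\<^esub> y = y"
      using absorb(2)[of y "z \<otimes>\<^bsub>C\<^esub> x"] comm(2,3)[of y "z \<otimes>\<^bsub>C\<^esub> x"] by (simp add: alg_le_def)
    then show "alg_le C z (x \<leadsto>\<^bsub>C\<^esub> y)"
      using res1[of x y z] by simp
  next
    assume "alg_le C z (x \<leadsto>\<^bsub>C\<^esub> y)"
    then show "alg_le C (z \<otimes>\<^bsub>C\<^esub> x) y"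
      using res2[of x y z] comm(2)[of z "x \<leadsto>\<^bsub>C\<^esub> y"] by (simp add: alg_le_def)
  qed
  have r_one: "x \<otimes>\<^bsub>C\<^esub> \<one>\<^bsub>C\<^esub> = x" if "x \<in> carrier C" for x
    using that comm(1) bounds(3) by simp
  show ?thesis
    by unfold_locales (fact comm assoc absorb bounds prelin residuation r_one | simp)+
qed

text \<open>Validity of a formula is itself an equation with \<open>TOne\<close>. Powers and
  quotients are recognised as L-algebras through this lemma.\<close>

lemma L_algebra_if_satisfies_eqs:
  assumes "L_algebra L A" "sig_algebra C" "\<And>s t. satisfies_eq A s t \<Longrightarrow> satisfies_eq C s t"
  shows "L_algebra L C"
  using assms mtl_algebra_if_satisfies_eqs unfolding L_algebra_def valid_in_iff_satisfies_eq by blast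

section \<open>Homomorphic images, powers and quotients\<close>

lemma term_eval_hom:
  assumes "sig_algebra D" "h \<in> alg_hom D C" "v \<in> UNIV \<rightarrow> carrier D"
  shows "h (term_eval D v t) = term_eval C (\<lambda>k. h (v k)) t"
  by (induction t) (auto simp: term_eval_in[OF assms(1,3)] alg_homD[OF assms(2)])

text \<open>A valuation in the image lifts to one in \<open>D\<close> by choosing preimages of the
  variables.\<close>

lemma satisfies_eq_image:
  assumes D: "sig_algebra D" and h: "h \<in> alg_hom D C" and onto: "h ` carrier D = carrier C"
    and eq: "satisfies_eq D s t"
  shows "satisfies_eq C s t"
  unfolding satisfies_eq_def
proof
  fix v :: "nat \<Rightarrow> 'b" assume v: "v \<in> UNIV \<rightarrow> carrier C"
  define w where "w k = inv_into (carrier D) h (v k)" for k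
  have w: "w \<in> UNIV \<rightarrow> carrier D" "v = (\<lambda>k. h (w k))"
    using v by (auto simp: w_def onto[symmetric] Pi_iff inv_into_into f_inv_into_f)
  then show "term_eval C v s = term_eval C v t"
    using eq by (simp add: term_eval_hom[OF D h, symmetric] satisfies_eq_def)
qed

abbreviation power_alg :: "'a mtl_struct \<Rightarrow> (nat \<Rightarrow> 'a) mtl_struct" where
  "power_alg A \<equiv> direct_product UNIV (\<lambda>_. A)"

lemma power_alg_simps [simp]:
  "carrier (power_alg A) = UNIV \<rightarrow> carrier A"
  "\<one>\<^bsub>power_alg A\<^esub> = (\<lambda>k. \<one>\<^bsub>A\<^esub>)"
  "\<zero>\<^bsub>power_alg A\<^esub> = (\<lambda>k. \<zero>\<^bsub>A\<^esub>)"
  "f \<otimes>\<^bsub>power_alg A\<^esub> g = (\<lambda>k. f k \<otimes>\<^bsub>A\<^esub> g k)"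
  "f \<leadsto>\<^bsub>power_alg A\<^esub> g = (\<lambda>k. f k \<leadsto>\<^bsub>A\<^esub> g k)"
  "f \<curlywedge>\<^bsub>power_alg A\<^esub> g = (\<lambda>k. f k \<curlywedge>\<^bsub>A\<^esub> g k)"
  "f \<curlyvee>\<^bsub>power_alg A\<^esub> g = (\<lambda>k. f k \<curlyvee>\<^bsub>A\<^esub> g k)"
  by (auto simp: direct_product_def)

lemma term_eval_power: "term_eval (power_alg A) v t k = term_eval A (\<lambda>j. v j k) t"
  by (induction t) simp_all

lemma L_algebra_power:
  assumes "L_algebra L A"
  shows "L_algebra L (power_alg A)"
proof (rule L_algebra_if_satisfies_eqs[OF assms])
  interpret mtl_algebra A
    using assms by (simp add: L_algebra_def)
  show "sig_algebra (power_alg A)"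
    by (auto simp: sig_algebra_def Pi_iff)
  show "satisfies_eq (power_alg A) s t" if "satisfies_eq A s t" for s t
    using that by (auto simp: satisfies_eq_def term_eval_power fun_eq_iff)
qed

lemma L_algebra_quotient:
  assumes "L_algebra L A" "mtl_filter A F"
  shows "L_algebra L (mtl_algebra.quotient A F)"
proof -
  interpret mtl_filter A F by fact
  show ?thesis
    by (rule L_algebra_if_satisfies_eqs[OF assms(1) sig_quotient])
      (rule satisfies_eq_image[OF sig_algebra_axioms hom_quotient carrier_quotient[symmetric]])
qed

section \<open>Countable complete subalgebras\<close>

instance fm :: countable
  by countable_datatype

text \<open>There are countably many formulas, and one refuting valuation for each unprovable
  formula suffices for completeness. The subalgebra generated by their values and by
  \<open>c\<close> is countable and so has a copy in any infinite type.\<close>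

lemma countable_L_subalgebra:
  fixes C :: "'c mtl_struct"
  assumes C: "L_algebra L C" and compl: "complete_wrt L C" and c: "c \<in> carrier C"
  obtains D :: "'a::infinite mtl_struct" and h where
    "L_algebra L D" "complete_wrt L D" "h \<in> embedding D C" "c \<in> h ` carrier D"
proof -
  interpret mtl_algebra C
    using C by (simp add: L_algebra_def)
  have "\<exists>v. v \<in> UNIV \<rightarrow> carrier C \<and> (\<not> L \<turnstile> \<phi> \<longrightarrow> eval C v \<phi> \<noteq> \<one>\<^bsub>C\<^esub>)" for \<phi>
    using compl zero_in by (cases "L \<turnstile> \<phi>") (auto simp: complete_wrt_def valid_in_def)
  then obtain v where v: "\<And>\<phi>. v \<phi> \<in> UNIV \<rightarrow> carrier C"
    and refutes: "\<And>\<phi>. \<not> L \<turnstile> \<phi> \<Longrightarrow> eval C (v \<phi>) \<phi> \<noteq> \<one>\<^bsub>C\<^esub>"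
    by metis
  \<comment> \<open>One valuation lists everything: the code of \<open>None\<close> yields
    \<open>c\<close>, and the code of \<open>Some (\<phi>, j)\<close> the value of variable
    \<open>j\<close> in the valuation for \<open>\<phi>\<close>.\<close>
  define u where "u k = (case from_nat k of None \<Rightarrow> c | Some (\<phi>, j) \<Rightarrow> v \<phi> j)" for k :: nat
  have "u \<in> UNIV \<rightarrow> carrier C"
    using v c by (auto simp: u_def Pi_iff split: option.split)
  then obtain D :: "'a mtl_struct" and h w where
    D: "sig_algebra D" and h: "h \<in> embedding D C" and w: "w \<in> UNIV \<rightarrow> carrier D"
    and u: "u = (\<lambda>k. h (w k))"
    using countable_copy[OF sig_algebra_axioms] by blast
  have LD: "L_algebra L D"
    by (rule L_algebra_sub[OF D h C])
  have "L \<turnstile> \<phi>" if "valid_in D \<phi>" for \<phi>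
  proof (rule ccontr)
    assume "\<not> L \<turnstile> \<phi>"
    define w' where "w' j = w (to_nat (Some (\<phi>, j)))" for j :: nat
    have w': "w' \<in> UNIV \<rightarrow> carrier D"
      using w by (auto simp: w'_def)
    have "v \<phi> j = h (w' j)" for j
      using fun_cong[OF u, of "to_nat (Some (\<phi>, j))"] by (simp add: w'_def u_def)
    then have "v \<phi> = (\<lambda>j. h (w' j))" ..
    then have "eval C (v \<phi>) \<phi> = \<one>\<^bsub>C\<^esub>"
      using that w' by (simp add: eval_embedding[OF D h w', symmetric] valid_in_def embedding_const[OF h])
    with refutes[OF \<open>\<not> L \<turnstile> \<phi>\<close>] show False ..
  qed
  then have "complete_wrt L D"
    using LD by (auto simp: complete_wrt_def L_algebra_def)
  moreover have "c = h (w (to_nat (None :: (fm \<times> nat) option)))"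
    using fun_cong[OF u, of "to_nat (None :: (fm \<times> nat) option)"] by (simp add: u_def)
  then have "c \<in> h ` carrier D"
    using w by blast
  ultimately show thesis
    using that LD h by blast
qed

lemma generic_if_complete:
  assumes A: "L_algebra L A" and "complete_wrt L A"
  shows "generic L A"
proof -
  have "L_algebra L C \<longleftrightarrow> sig_algebra C \<and> (\<forall>s t. satisfies_eq A s t \<longrightarrow> satisfies_eq C s t)"
    for C :: "'a mtl_struct"
  proof
    assume C: "L_algebra L C"
    then show "sig_algebra C \<and> (\<forall>s t. satisfies_eq A s t \<longrightarrow> satisfies_eq C s t)"
      using satisfies_eq_if_complete[OF assms C] by (simp add: L_algebra_def mtl_algebra_def)
  qed (use L_algebra_if_satisfies_eqs[OF A] in blast)
  then show ?thesis
    using A by (auto simp: generic_def generated_variety_def)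
qed

section \<open>The Lindenbaum algebra\<close>

lemma subst_subst: "subst \<sigma> (subst \<tau> \<phi>) = subst (\<lambda>k. subst \<sigma> (\<tau> k)) \<phi>"
  by (induction \<phi>) simp_all

lemma mtl_axiom_subst: "mtl_axiom \<phi> \<Longrightarrow> mtl_axiom (subst \<sigma> \<phi>)"
  by (induction rule: mtl_axiom.induct) (simp_all add: mtl_axiom.intros)

text \<open>Axioms are schemata, so derivations can be instantiated throughout. This makes the
  Lindenbaum algebra validate theorems under all valuations, not only the canonical one.\<close>

lemma provable_subst: "L \<turnstile> \<phi> \<Longrightarrow> L \<turnstile> subst \<sigma> \<phi>"
proof (induction rule: provable.induct)
  case (modus_ponens \<phi> \<psi>)
  then show ?case by (auto intro: provable.modus_ponens)
qed (auto simp: subst_subst intro: provable.mtl provable.schema mtl_axiom_subst)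

section \<open>Derived theorems of the calculus\<close>

context
  fixes L :: "fm set"
begin

lemmas provable_axiom = mtl_axiom.intros[THEN provable.mtl[of _ L]]
lemmas provable_mp = provable.modus_ponens[of L]

lemma imp_trans:
  "L \<turnstile> \<phi> \<^bold>\<rightarrow> \<psi> \<Longrightarrow> L \<turnstile> \<psi> \<^bold>\<rightarrow> \<chi> \<Longrightarrow> L \<turnstile> \<phi> \<^bold>\<rightarrow> \<chi>"
  by (rule provable_mp[OF provable_mp[OF provable_axiom(1)]])

lemma conj_imp_iff: "L \<turnstile> \<phi> \<^bold>& \<psi> \<^bold>\<rightarrow> \<chi> \<longleftrightarrow> L \<turnstile> \<phi> \<^bold>\<rightarrow> \<psi> \<^bold>\<rightarrow> \<chi>"
  using provable_mp provable_axiom(7,8) by blast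

lemma conj_imp1: "L \<turnstile> \<phi> \<^bold>& \<psi> \<^bold>\<rightarrow> \<phi>"
  by (rule provable_axiom(2))

lemma conj_commute: "L \<turnstile> \<phi> \<^bold>& \<psi> \<^bold>\<rightarrow> \<psi> \<^bold>& \<phi>"
  by (rule provable_axiom(3))

lemma conj_imp2: "L \<turnstile> \<phi> \<^bold>& \<psi> \<^bold>\<rightarrow> \<psi>"
  using imp_trans conj_commute conj_imp1 by blast

lemma weaken: "L \<turnstile> \<psi> \<Longrightarrow> L \<turnstile> \<phi> \<^bold>\<rightarrow> \<psi>"
  using provable_mp conj_imp1 conj_imp_iff by blast

lemma imp_refl: "L \<turnstile> \<phi> \<^bold>\<rightarrow> \<phi>"
  using provable_mp[OF _ provable_axiom(10)] conj_imp2 conj_imp_iff by blast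

lemma imp_swap: "L \<turnstile> \<phi> \<^bold>\<rightarrow> \<psi> \<^bold>\<rightarrow> \<chi> \<Longrightarrow> L \<turnstile> \<psi> \<^bold>\<rightarrow> \<phi> \<^bold>\<rightarrow> \<chi>"
  using imp_trans conj_commute conj_imp_iff by blast

lemma conj_mono_left: "L \<turnstile> \<phi> \<^bold>\<rightarrow> \<phi>' \<Longrightarrow> L \<turnstile> \<phi> \<^bold>& \<psi> \<^bold>\<rightarrow> \<phi>' \<^bold>& \<psi>"
  using imp_trans imp_refl conj_imp_iff by blast

lemma conj_mono: "L \<turnstile> \<phi> \<^bold>\<rightarrow> \<phi>' \<Longrightarrow> L \<turnstile> \<psi> \<^bold>\<rightarrow> \<psi>' \<Longrightarrow> L \<turnstile> \<phi> \<^bold>& \<psi> \<^bold>\<rightarrow> \<phi>' \<^bold>& \<psi>'"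
  using imp_trans conj_commute conj_mono_left by meson

lemma modus_ponens_imp: "L \<turnstile> (\<phi> \<^bold>\<rightarrow> \<psi>) \<^bold>& \<phi> \<^bold>\<rightarrow> \<psi>"
  by (simp add: conj_imp_iff imp_refl)

lemma imp_mono:
  assumes "L \<turnstile> \<phi>' \<^bold>\<rightarrow> \<phi>" "L \<turnstile> \<psi> \<^bold>\<rightarrow> \<psi>'"
  shows "L \<turnstile> (\<phi> \<^bold>\<rightarrow> \<psi>) \<^bold>\<rightarrow> (\<phi>' \<^bold>\<rightarrow> \<psi>')"
  unfolding conj_imp_iff[symmetric]
  using imp_trans[OF imp_trans[OF conj_mono[OF imp_refl assms(1)] modus_ponens_imp] assms(2)] .

lemma conj_assoc1: "L \<turnstile> (\<phi> \<^bold>& \<psi>) \<^bold>& \<chi> \<^bold>\<rightarrow> \<phi> \<^bold>& (\<psi> \<^bold>& \<chi>)"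
proof -
  have "L \<turnstile> \<phi> \<^bold>\<rightarrow> \<psi> \<^bold>& \<chi> \<^bold>\<rightarrow> \<phi> \<^bold>& (\<psi> \<^bold>& \<chi>)"
    using imp_refl conj_imp_iff by blast
  then show ?thesis
    unfolding conj_imp_iff by (rule imp_trans[OF _ provable_axiom(8)])
qed

lemma conj_assoc2: "L \<turnstile> \<phi> \<^bold>& (\<psi> \<^bold>& \<chi>) \<^bold>\<rightarrow> (\<phi> \<^bold>& \<psi>) \<^bold>& \<chi>"
  using imp_trans conj_commute conj_assoc1 conj_mono_left by meson

lemma meet_imp1: "L \<turnstile> \<phi> \<^bold>\<and> \<psi> \<^bold>\<rightarrow> \<phi>"
  by (rule provable_axiom(4))

lemma meet_imp2: "L \<turnstile> \<phi> \<^bold>\<and> \<psi> \<^bold>\<rightarrow> \<psi>"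
  using imp_trans provable_axiom(4,5) by blast

lemma prelinear_cases: "L \<turnstile> (\<phi> \<^bold>\<rightarrow> \<psi>) \<^bold>\<rightarrow> \<chi> \<Longrightarrow> L \<turnstile> (\<psi> \<^bold>\<rightarrow> \<phi>) \<^bold>\<rightarrow> \<chi> \<Longrightarrow> L \<turnstile> \<chi>"
  by (rule provable_mp[OF provable_mp[OF provable_axiom(9)]])

text \<open>The case split by prelinearity reduces this to the axiom deriving a meet from a formula
  conjoined with an implication: in each case \<open>\<chi>\<close> supplies the antecedent of the
  assumed implication.\<close>

lemma imp_meetI:
  assumes "L \<turnstile> \<chi> \<^bold>\<rightarrow> \<phi>" "L \<turnstile> \<chi> \<^bold>\<rightarrow> \<psi>"
  shows "L \<turnstile> \<chi> \<^bold>\<rightarrow> \<phi> \<^bold>\<and> \<psi>"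
proof (rule prelinear_cases)
  have *: "L \<turnstile> (\<alpha> \<^bold>\<rightarrow> \<beta>) \<^bold>\<rightarrow> \<chi> \<^bold>\<rightarrow> \<beta> \<^bold>\<and> \<alpha>" if "L \<turnstile> \<chi> \<^bold>\<rightarrow> \<alpha>" for \<alpha> \<beta>
    using conj_mono_left[OF that, of "\<alpha> \<^bold>\<rightarrow> \<beta>"] provable_axiom(6) imp_trans conj_imp_iff imp_swap by meson
  \<comment> \<open>The auxiliary fact gives the meet in reversed order, so this case also needs
    commutativity.\<close>
  show "L \<turnstile> (\<phi> \<^bold>\<rightarrow> \<psi>) \<^bold>\<rightarrow> \<chi> \<^bold>\<rightarrow> \<phi> \<^bold>\<and> \<psi>"
    using *[OF assms(1)] imp_mono[OF imp_refl provable_axiom(5)] imp_trans by blast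
  show "L \<turnstile> (\<psi> \<^bold>\<rightarrow> \<phi>) \<^bold>\<rightarrow> \<chi> \<^bold>\<rightarrow> \<phi> \<^bold>\<and> \<psi>"
    using *[OF assms(2)] .
qed

lemma imp_disj1: "L \<turnstile> \<phi> \<^bold>\<rightarrow> \<phi> \<^bold>\<or> \<psi>"
  and imp_disj2: "L \<turnstile> \<psi> \<^bold>\<rightarrow> \<phi> \<^bold>\<or> \<psi>"
proof -
  have "L \<turnstile> \<alpha> \<^bold>\<rightarrow> (\<alpha> \<^bold>\<rightarrow> \<beta>) \<^bold>\<rightarrow> \<beta>" "L \<turnstile> \<alpha> \<^bold>\<rightarrow> (\<beta> \<^bold>\<rightarrow> \<alpha>) \<^bold>\<rightarrow> \<alpha>" for \<alpha> \<beta>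
    using imp_swap[OF imp_refl] conj_imp1 conj_imp_iff by blast+
  then show "L \<turnstile> \<phi> \<^bold>\<rightarrow> \<phi> \<^bold>\<or> \<psi>" "L \<turnstile> \<psi> \<^bold>\<rightarrow> \<phi> \<^bold>\<or> \<psi>"
    by (simp_all add: Disj_def imp_meetI)
qed

text \<open>In each prelinearity case one meet component of the disjunction can be detached and
  yields the larger disjunct.\<close>

lemma disj_impI:
  assumes "L \<turnstile> \<phi> \<^bold>\<rightarrow> \<chi>" "L \<turnstile> \<psi> \<^bold>\<rightarrow> \<chi>"
  shows "L \<turnstile> \<phi> \<^bold>\<or> \<psi> \<^bold>\<rightarrow> \<chi>"
proof (rule prelinear_cases)
  have *: "L \<turnstile> (\<alpha> \<^bold>\<rightarrow> \<beta>) \<^bold>\<rightarrow> \<delta> \<^bold>\<rightarrow> \<chi>" if "L \<turnstile> \<delta> \<^bold>\<rightarrow> (\<alpha> \<^bold>\<rightarrow> \<beta>) \<^bold>\<rightarrow> \<beta>" "L \<turnstile> \<beta> \<^bold>\<rightarrow> \<chi>" for \<alpha> \<beta> \<delta>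
    using imp_swap[OF that(1)] imp_mono[OF imp_refl that(2)] imp_trans by blast
  show "L \<turnstile> (\<phi> \<^bold>\<rightarrow> \<psi>) \<^bold>\<rightarrow> \<phi> \<^bold>\<or> \<psi> \<^bold>\<rightarrow> \<chi>" "L \<turnstile> (\<psi> \<^bold>\<rightarrow> \<phi>) \<^bold>\<rightarrow> \<phi> \<^bold>\<or> \<psi> \<^bold>\<rightarrow> \<chi>"
    using assms by (auto intro: * simp: Disj_def meet_imp1 meet_imp2)
qed

lemma prelinear: "L \<turnstile> (\<phi> \<^bold>\<rightarrow> \<psi>) \<^bold>\<or> (\<psi> \<^bold>\<rightarrow> \<phi>)"
  by (rule prelinear_cases) (rule imp_disj1, rule imp_disj2)

lemma provable_top: "L \<turnstile> \<^bold>\<top>"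
  by (simp add: fm_top_def imp_refl)

end

section \<open>Formulas modulo provable equivalence\<close>

definition equiv_class :: "fm set \<Rightarrow> fm \<Rightarrow> fm set" where
  "equiv_class L \<phi> = {\<psi>. L \<turnstile> \<phi> \<^bold>\<rightarrow> \<psi> \<and> L \<turnstile> \<psi> \<^bold>\<rightarrow> \<phi>}"

text \<open>The syntactic algebra before any identification, with the derived formulas in the places
  of \<open>\<one>\<close> and the join. The MTL laws are established only for its quotient.\<close>

definition fm_algebra :: "fm mtl_struct" where
  "fm_algebra = \<lparr>carrier = UNIV, monoid.mult = Conj, one = \<^bold>\<top>, resid = Imp, inf_op = Meet,
     sup_op = Disj, zero = \<^bold>\<bottom>\<rparr>"

abbreviation lindenbaum :: "fm set \<Rightarrow> fm set mtl_struct" where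
  "lindenbaum L \<equiv> transport (equiv_class L) fm_algebra"

lemma equiv_class_eq_iff:
  "equiv_class L \<phi> = equiv_class L \<psi> \<longleftrightarrow> L \<turnstile> \<phi> \<^bold>\<rightarrow> \<psi> \<and> L \<turnstile> \<psi> \<^bold>\<rightarrow> \<phi>"
proof
  assume "equiv_class L \<phi> = equiv_class L \<psi>"
  then have "\<psi> \<in> equiv_class L \<phi>"
    by (simp add: equiv_class_def imp_refl)
  then show "L \<turnstile> \<phi> \<^bold>\<rightarrow> \<psi> \<and> L \<turnstile> \<psi> \<^bold>\<rightarrow> \<phi>"
    by (simp add: equiv_class_def)
qed (auto simp: equiv_class_def intro: imp_trans)

lemma lindenbaum:
  shows sig_lindenbaum: "sig_algebra (lindenbaum L)"
    and carrier_lindenbaum: "carrier (lindenbaum L) = range (equiv_class L)"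
    and hom_lindenbaum: "equiv_class L \<in> alg_hom fm_algebra (lindenbaum L)"
proof -
  have "sig_algebra fm_algebra"
    by (simp add: sig_algebra_def fm_algebra_def)
  moreover have "L \<turnstile> \<phi> \<^bold>\<or> \<psi> \<^bold>\<rightarrow> \<phi>' \<^bold>\<or> \<psi>'" "L \<turnstile> \<phi> \<^bold>\<and> \<psi> \<^bold>\<rightarrow> \<phi>' \<^bold>\<and> \<psi>'"
    if "L \<turnstile> \<phi> \<^bold>\<rightarrow> \<phi>'" "L \<turnstile> \<psi> \<^bold>\<rightarrow> \<psi>'" for \<phi> \<psi> \<phi>' \<psi>'
    using that imp_trans
    by (meson disj_impI imp_disj1 imp_disj2, meson imp_meetI meet_imp1 meet_imp2)
  ultimately have *: "sig_algebra (lindenbaum L)"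
    "carrier (lindenbaum L) = equiv_class L ` carrier fm_algebra"
    "equiv_class L \<in> alg_hom fm_algebra (lindenbaum L)"
    by (rule_tac [!] transport_kernel)
      (auto simp: fm_algebra_def equiv_class_eq_iff conj_mono imp_mono)
  then show "sig_algebra (lindenbaum L)" "carrier (lindenbaum L) = range (equiv_class L)"
    "equiv_class L \<in> alg_hom fm_algebra (lindenbaum L)"
    by (simp_all add: fm_algebra_def)
qed

lemma lindenbaum_simps:
  "\<one>\<^bsub>lindenbaum L\<^esub> = equiv_class L \<^bold>\<top>"
  "\<zero>\<^bsub>lindenbaum L\<^esub> = equiv_class L \<^bold>\<bottom>"
  "equiv_class L \<phi> \<otimes>\<^bsub>lindenbaum L\<^esub> equiv_class L \<psi> = equiv_class L (\<phi> \<^bold>& \<psi>)"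
  "equiv_class L \<phi> \<leadsto>\<^bsub>lindenbaum L\<^esub> equiv_class L \<psi> = equiv_class L (\<phi> \<^bold>\<rightarrow> \<psi>)"
  "equiv_class L \<phi> \<curlywedge>\<^bsub>lindenbaum L\<^esub> equiv_class L \<psi> = equiv_class L (\<phi> \<^bold>\<and> \<psi>)"
  "equiv_class L \<phi> \<curlyvee>\<^bsub>lindenbaum L\<^esub> equiv_class L \<psi> = equiv_class L (\<phi> \<^bold>\<or> \<psi>)"
  using alg_homD(1,2)[OF hom_lindenbaum[of L]] alg_homD(4-7)[OF hom_lindenbaum[of L], of \<phi> \<psi>]
  by (simp_all add: fm_algebra_def)

lemma lindenbaum_le:
  "alg_le (lindenbaum L) (equiv_class L \<phi>) (equiv_class L \<psi>) \<longleftrightarrow> L \<turnstile> \<phi> \<^bold>\<rightarrow> \<psi>"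
  unfolding alg_le_def lindenbaum_simps equiv_class_eq_iff
  using imp_trans imp_meetI meet_imp1 meet_imp2 imp_refl by metis

lemma equiv_class_eq_one: "equiv_class L \<phi> = \<one>\<^bsub>lindenbaum L\<^esub> \<longleftrightarrow> L \<turnstile> \<phi>"
  unfolding lindenbaum_simps equiv_class_eq_iff using weaken provable_top provable.modus_ponens by metis

text \<open>A valuation in the Lindenbaum algebra is a substitution up to equivalence, so validity
  there becomes provability of substitution instances.\<close>

lemma lindenbaum_eval:
  "eval (lindenbaum L) (\<lambda>k. equiv_class L (\<sigma> k)) \<phi> = equiv_class L (subst \<sigma> \<phi>)"
  by (induction \<phi>) (simp_all add: lindenbaum_simps)

lemma mtl_algebra_lindenbaum: "mtl_algebra (lindenbaum L)"
proof -
  interpret sig_algebra "lindenbaum L" by (rule sig_lindenbaum)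
  note [intro!] = imp_meetI disj_impI
  have meet [intro]: "L \<turnstile> \<phi> \<^bold>\<rightarrow> \<chi> \<Longrightarrow> L \<turnstile> \<phi> \<^bold>\<and> \<psi> \<^bold>\<rightarrow> \<chi>" "L \<turnstile> \<psi> \<^bold>\<rightarrow> \<chi> \<Longrightarrow> L \<turnstile> \<phi> \<^bold>\<and> \<psi> \<^bold>\<rightarrow> \<chi>"
    and disj [intro]: "L \<turnstile> \<chi> \<^bold>\<rightarrow> \<phi> \<Longrightarrow> L \<turnstile> \<chi> \<^bold>\<rightarrow> \<phi> \<^bold>\<or> \<psi>" "L \<turnstile> \<chi> \<^bold>\<rightarrow> \<psi> \<Longrightarrow> L \<turnstile> \<chi> \<^bold>\<rightarrow> \<phi> \<^bold>\<or> \<psi>"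
    for \<phi> \<psi> \<chi>
    using imp_trans meet_imp1 meet_imp2 imp_disj1 imp_disj2 by meson+
  have top: "L \<turnstile> \<^bold>\<top> \<^bold>& \<phi> \<^bold>\<rightarrow> \<phi>" "L \<turnstile> \<phi> \<^bold>\<rightarrow> \<^bold>\<top> \<^bold>& \<phi>" "L \<turnstile> \<phi> \<^bold>& \<^bold>\<top> \<^bold>\<rightarrow> \<phi>" "L \<turnstile> \<phi> \<^bold>\<rightarrow> \<phi> \<^bold>& \<^bold>\<top>" for \<phi>
  proof -
    show "L \<turnstile> \<phi> \<^bold>\<rightarrow> \<^bold>\<top> \<^bold>& \<phi>"
      by (rule provable.modus_ponens[OF _ provable_top]) (simp add: imp_refl flip: conj_imp_iff)
    then show "L \<turnstile> \<phi> \<^bold>\<rightarrow> \<phi> \<^bold>& \<^bold>\<top>"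
      using conj_commute by (rule imp_trans)
  qed (rule conj_imp1 conj_imp2)+
  note simps = lindenbaum_simps lindenbaum_le equiv_class_eq_iff
  show ?thesis
  proof unfold_locales
    fix x assume "x \<in> carrier (lindenbaum L)"
    then obtain \<phi> where x: "x = equiv_class L \<phi>"
      by (auto simp: carrier_lindenbaum)
    show "\<one>\<^bsub>lindenbaum L\<^esub> \<otimes>\<^bsub>lindenbaum L\<^esub> x = x" "x \<otimes>\<^bsub>lindenbaum L\<^esub> \<one>\<^bsub>lindenbaum L\<^esub> = x"
      "alg_le (lindenbaum L) \<zero>\<^bsub>lindenbaum L\<^esub> x" "alg_le (lindenbaum L) x \<one>\<^bsub>lindenbaum L\<^esub>"
      unfolding x simps by (simp_all add: top weaken provable_top provable.mtl mtl_axiom.intros(10))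
    fix y assume "y \<in> carrier (lindenbaum L)"
    then obtain \<psi> where y: "y = equiv_class L \<psi>"
      by (auto simp: carrier_lindenbaum)
    show "x \<otimes>\<^bsub>lindenbaum L\<^esub> y = y \<otimes>\<^bsub>lindenbaum L\<^esub> x"
      unfolding x y simps by (simp add: conj_commute)
    show "x \<curlywedge>\<^bsub>lindenbaum L\<^esub> y = y \<curlywedge>\<^bsub>lindenbaum L\<^esub> x" "x \<curlyvee>\<^bsub>lindenbaum L\<^esub> y = y \<curlyvee>\<^bsub>lindenbaum L\<^esub> x"
      "x \<curlywedge>\<^bsub>lindenbaum L\<^esub> (x \<curlyvee>\<^bsub>lindenbaum L\<^esub> y) = x" "x \<curlyvee>\<^bsub>lindenbaum L\<^esub> (x \<curlywedge>\<^bsub>lindenbaum L\<^esub> y) = x"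
      unfolding x y simps using imp_refl[of L] by blast+
    show "(x \<leadsto>\<^bsub>lindenbaum L\<^esub> y) \<curlyvee>\<^bsub>lindenbaum L\<^esub> (y \<leadsto>\<^bsub>lindenbaum L\<^esub> x) = \<one>\<^bsub>lindenbaum L\<^esub>"
      unfolding x y simps by (simp add: prelinear weaken provable_top)
    fix z assume "z \<in> carrier (lindenbaum L)"
    then obtain \<chi> where z: "z = equiv_class L \<chi>"
      by (auto simp: carrier_lindenbaum)
    show "x \<otimes>\<^bsub>lindenbaum L\<^esub> y \<otimes>\<^bsub>lindenbaum L\<^esub> z = x \<otimes>\<^bsub>lindenbaum L\<^esub> (y \<otimes>\<^bsub>lindenbaum L\<^esub> z)"
      unfolding x y z simps by (simp add: conj_assoc1 conj_assoc2)
    show "x \<curlywedge>\<^bsub>lindenbaum L\<^esub> y \<curlywedge>\<^bsub>lindenbaum L\<^esub> z = x \<curlywedge>\<^bsub>lindenbaum L\<^esub> (y \<curlywedge>\<^bsub>lindenbaum L\<^esub> z)"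
      "x \<curlyvee>\<^bsub>lindenbaum L\<^esub> y \<curlyvee>\<^bsub>lindenbaum L\<^esub> z = x \<curlyvee>\<^bsub>lindenbaum L\<^esub> (y \<curlyvee>\<^bsub>lindenbaum L\<^esub> z)"
      unfolding x y z simps using imp_refl[of L] by blast+
    show "alg_le (lindenbaum L) (z \<otimes>\<^bsub>lindenbaum L\<^esub> x) y = alg_le (lindenbaum L) z (x \<leadsto>\<^bsub>lindenbaum L\<^esub> y)"
      unfolding x y z simps by (rule conj_imp_iff)
  qed (simp_all add: mult_in one_in)
qed

lemma L_algebra_lindenbaum: "L_algebra L (lindenbaum L)"
  unfolding L_algebra_def valid_in_def
proof (intro conjI allI impI ballI)
  fix \<phi> and v :: "nat \<Rightarrow> fm set" assume \<phi>: "L \<turnstile> \<phi>" and "v \<in> UNIV \<rightarrow> carrier (lindenbaum L)"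
  then have "\<exists>\<psi>. v k = equiv_class L \<psi>" for k
    by (auto simp: carrier_lindenbaum)
  then obtain \<sigma> where "v = (\<lambda>k. equiv_class L (\<sigma> k))"
    by metis
  then show "eval (lindenbaum L) v \<phi> = \<one>\<^bsub>lindenbaum L\<^esub>"
    using \<phi> by (simp add: lindenbaum_eval equiv_class_eq_one provable_subst)
qed (rule mtl_algebra_lindenbaum)

lemma subst_Var [simp]: "subst Var \<phi> = \<phi>"
  by (induction \<phi>) simp_all

text \<open>Under the valuation sending each variable to its own class, a formula takes its own
  class as value.\<close>

lemma complete_lindenbaum: "complete_wrt L (lindenbaum L)"
proof -
  have "L \<turnstile> \<phi>" if "valid_in (lindenbaum L) \<phi>" for \<phi>
  proof -
    have "eval (lindenbaum L) (\<lambda>k. equiv_class L (Var k)) \<phi> = \<one>\<^bsub>lindenbaum L\<^esub>"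
      using that by (simp add: valid_in_def carrier_lindenbaum)
    then show ?thesis
      by (simp add: lindenbaum_eval equiv_class_eq_one)
  qed
  then show ?thesis
    using L_algebra_lindenbaum by (auto simp: complete_wrt_def L_algebra_def)
qed

text \<open>The Lindenbaum algebra has elements of another type than \<open>A\<close>, so a
  countable complete copy \<open>D\<close> over \<open>'a\<close> replaces it. As \<open>D\<close>
  lies in the variety generated by \<open>A\<close>, formulas valid in \<open>A\<close> are valid in
  \<open>D\<close> and therefore provable.\<close>

lemma complete_if_generic:
  fixes A :: "'a::infinite mtl_struct"
  assumes "generic L A"
  shows "complete_wrt L A"
proof -
  obtain D :: "'a mtl_struct" where D: "L_algebra L D" "complete_wrt L D"
    using countable_L_subalgebra[OF L_algebra_lindenbaum complete_lindenbaum
        sig_algebra.one_in[OF sig_lindenbaum]] by metis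
  have "satisfies_eq D s t" if "satisfies_eq A s t" for s t
    using assms D(1) that by (auto simp: generic_def generated_variety_def)
  then show ?thesis
    using assms D(2) unfolding complete_wrt_def generic_def L_algebra_def valid_in_iff_satisfies_eq
    by blast
qed

section \<open>Single chain completeness\<close>

lemma alg_le_embedding:
  assumes "h \<in> embedding D C" "sig_algebra D" "x \<in> carrier D" "y \<in> carrier D"
  shows "alg_le C (h x) (h y) \<longleftrightarrow> alg_le D x y"
  using assms
  by (simp add: alg_le_def embedding_sig(4)[symmetric] embedding_eq_iff[OF assms(1), symmetric]
      sig_algebra.inf_in)

lemma embedding_pow:
  assumes "h \<in> embedding D C" "mtl_algebra D" "x \<in> carrier D"
  shows "h (x [^]\<^bsub>D\<^esub> (m::nat)) = h x [^]\<^bsub>C\<^esub> m"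
proof -
  interpret mtl_algebra D by fact
  show ?thesis
    using assms
    by (induction m) (simp_all add: nat_pow_def embedding_sig embedding_const flip: nat_pow_def)
qed

lemma single_chain_complete_if_subdirect:
  assumes "subdirect_single_chain_complete TYPE('b::infinite) L"
  shows "single_chain_complete TYPE('a::infinite) L"
proof -
  obtain A :: "'b mtl_struct" where A: "L_algebra L A" "subdirectly_irreducible A" "generic L A"
    using assms by (auto simp: subdirect_single_chain_complete_def)
  interpret mtl_algebra A
    using A(1) by (simp add: L_algebra_def)
  obtain D :: "'a mtl_struct" and h where
    D: "L_algebra L D" "complete_wrt L D" and h: "h \<in> embedding D A"
    \<comment> \<open>The distinguished element is arbitrary here; passing to a subalgebra only
      changes the carrier type, and linearity is inherited.\<close>
    using countable_L_subalgebra[OF A(1) complete_if_generic[OF A(3)] one_in] by metis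
  have "sig_algebra D"
    using D(1) by (simp add: L_algebra_def mtl_algebra_def)
  then have "totally_ordered D"
    using subdirectly_irreducible_imp_chain[OF A(2)] embedding_sig(1)[OF h]
    by (simp add: totally_ordered_def alg_le_embedding[OF h, symmetric])
  then show ?thesis
    using D by (auto simp: single_chain_complete_def L_chain_def)
qed

lemma subdirect_if_single_chain_complete:
  assumes "single_chain_complete TYPE('a) L"
  shows "subdirect_single_chain_complete TYPE('b::infinite) L"
proof -
  obtain A :: "'a mtl_struct" where A: "L_algebra L A" "totally_ordered A" "complete_wrt L A"
    using assms by (auto simp: single_chain_complete_def L_chain_def)
  interpret A: mtl_algebra A
    using A(1) by (simp add: L_algebra_def)
  have suff: ?thesis if "L_algebra L D" "complete_wrt L D" "subdirectly_irreducible D"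
    for D :: "'b mtl_struct"
    using that generic_if_complete by (auto simp: subdirect_single_chain_complete_def)
  show ?thesis
  \<comment> \<open>An inconsistent logic has only trivial algebras, which contain no values below
    \<open>\<one>\<close> to start from.\<close>
  proof (cases "L \<turnstile> \<^bold>\<bottom>")
    case True
    obtain D :: "'b mtl_struct" where D: "L_algebra L D" "complete_wrt L D"
      using countable_L_subalgebra[OF A(1,3) A.one_in] by metis
    then interpret mtl_algebra D
      by (simp add: L_algebra_def)
    have "valid_in D \<^bold>\<bottom>"
      using D True by (simp add: L_algebra_def)
    then have "\<zero>\<^bsub>D\<^esub> = \<one>\<^bsub>D\<^esub>"
      by (auto simp: valid_in_def)
    then show ?thesis
      using suff D subdirectly_irreducible_trivial by blast
  next
    case False
    then have zero_one: "\<zero>\<^bsub>A\<^esub> \<noteq> \<one>\<^bsub>A\<^esub>"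
      using A(3) by (auto simp: complete_wrt_def valid_in_def)

    \<comment> \<open>The increasing sequence of refuting values\<close>
    have "\<exists>v. v \<in> UNIV \<rightarrow> carrier A \<and> (\<not> L \<turnstile> \<phi> \<longrightarrow> eval A v \<phi> \<noteq> \<one>\<^bsub>A\<^esub>)" for \<phi>
      using A(3) A.one_in by (cases "L \<turnstile> \<phi>") (auto simp: complete_wrt_def valid_in_def)
    then obtain v where v: "\<And>\<phi>. v \<phi> \<in> UNIV \<rightarrow> carrier A"
      and refutes: "\<And>\<phi>. \<not> L \<turnstile> \<phi> \<Longrightarrow> eval A (v \<phi>) \<phi> \<noteq> \<one>\<^bsub>A\<^esub>"
      by metis
    \<comment> \<open>The default \<open>\<zero>\<close> at codes of provable formulas keeps every
      \<open>a k\<close> different from \<open>\<one>\<close>.\<close>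
    define a where "a k = (let \<phi> = from_nat k in if L \<turnstile> \<phi> then \<zero>\<^bsub>A\<^esub> else eval A (v \<phi>) \<phi>)" for k
    define c where "c = rec_nat (a 0) (\<lambda>k x. x \<curlyvee>\<^bsub>A\<^esub> a (Suc k))"
    have a [simp]: "a k \<in> carrier A" "a k \<noteq> \<one>\<^bsub>A\<^esub>" for k
      using zero_one refutes v by (auto simp: a_def Let_def eval_in)
    have c_simps: "c 0 = a 0" "c (Suc k) = c k \<curlyvee>\<^bsub>A\<^esub> a (Suc k)" for k
      by (simp_all add: c_def)
    have c [simp]: "c k \<in> carrier A" for k
      by (induction k) (simp_all add: c_simps)
    \<comment> \<open>In a chain the join of two elements is one of them, so finite joins of values
      below \<open>\<one>\<close> stay below \<open>\<one>\<close>.\<close>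
    have c1: "c k \<noteq> \<one>\<^bsub>A\<^esub>" for k
    proof (induction k)
      case (Suc k)
      have "alg_le A (c k) (a (Suc k)) \<or> alg_le A (a (Suc k)) (c k)"
        using A(2) by (simp add: totally_ordered_def)
      then have "c (Suc k) = a (Suc k) \<or> c (Suc k) = c k"
        by (auto simp: c_simps A.le_iff_sup A.sup_commute)
      then show ?case
        using Suc by auto
    qed (simp add: c_simps)
    have ac: "alg_le A (a i) (c k)" if "i \<le> k" for i k
      using that
    proof (induction k rule: dec_induct)
      case base
      show ?case
        by (cases i) (simp_all add: c_simps A.sup_ge2)
    next
      case (step k)
      then show ?case
        using A.le_trans[OF step(3) A.sup_ge1[OF c a(1)]] by (simp add: c_simps)
    qed

    \<comment> \<open>The power of the chain and a quotient with a least nontrivial filter\<close>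
    let ?M = "power_alg A"
    have M: "L_algebra L ?M"
      by (rule L_algebra_power[OF A(1)])
    then interpret M: mtl_algebra ?M
      by (simp add: L_algebra_def)
    have M_le: "alg_le ?M f g \<longleftrightarrow> (\<forall>k. alg_le A (f k) (g k))" for f g
      by (simp add: alg_le_def fun_eq_iff)
    define F0 where "F0 = {f \<in> carrier ?M. \<exists>n. \<forall>k\<ge>n. f k = \<one>\<^bsub>A\<^esub>}"
    have F0: "M.is_filter F0"
      unfolding M.is_filter_def
    proof (intro conjI ballI impI)
      fix f g assume "f \<in> F0"
      then obtain m where f: "f \<in> carrier ?M" and m: "\<forall>k\<ge>m. f k = \<one>\<^bsub>A\<^esub>"
        unfolding F0_def by blast
      show "g \<in> F0" if g: "g \<in> carrier ?M" "alg_le ?M f g"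
      proof -
        have "g k = \<one>\<^bsub>A\<^esub>" if "k \<ge> m" for k
        proof -
          have "g k \<in> carrier A" "alg_le A (f k) (g k)"
            using g M_le by auto
          then show ?thesis
            using m that by simp
        qed
        then show ?thesis
          using g unfolding F0_def by blast
      qed
      assume "g \<in> F0"
      then obtain n where g: "g \<in> carrier ?M" and n: "\<forall>k\<ge>n. g k = \<one>\<^bsub>A\<^esub>"
        unfolding F0_def by blast
      have "\<forall>k\<ge>max m n. (f \<otimes>\<^bsub>?M\<^esub> g) k = \<one>\<^bsub>A\<^esub>"
        using m n by simp
      then show "f \<otimes>\<^bsub>?M\<^esub> g \<in> F0"
        using M.mult_in[OF f g] unfolding F0_def by blast
    qed (auto simp: F0_def)
    have cM: "c \<in> carrier ?M" and cF0: "c \<notin> F0"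
      using c1 by (auto simp: F0_def)
    obtain F where F: "M.is_filter F" "F0 \<subseteq> F" "c \<notin> F"
      and max: "\<And>x. \<lbrakk>x \<in> carrier ?M; x \<notin> F\<rbrakk> \<Longrightarrow> \<exists>m::nat. M.fle F (x [^]\<^bsub>?M\<^esub> m) c"
      using M.maximal_filter_avoiding[OF F0 cM cF0] by metis
    interpret F: mtl_filter ?M F
      by unfold_locales (rule F(1))
    let ?Q = "M.quotient F"
    have Q: "L_algebra L ?Q"
      by (rule L_algebra_quotient[OF M]) unfold_locales
    then interpret Q: mtl_algebra ?Q
      by (simp add: L_algebra_def)
    let ?q = "M.fclass F"
    have Q_one: "\<one>\<^bsub>?Q\<^esub> = ?q \<one>\<^bsub>?M\<^esub>"
      using alg_homD(1)[OF F.hom_quotient] by simp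

    \<comment> \<open>Completeness of the quotient\<close>
    have "L \<turnstile> \<phi>" if "valid_in ?Q \<phi>" for \<phi>
    proof (rule ccontr)
      assume unprov: "\<not> L \<turnstile> \<phi>"
      \<comment> \<open>The refuting valuation is repeated in every coordinate, so
        \<open>\<phi>\<close> evaluates to the constant sequence with value \<open>a i\<close>,
        where \<open>i\<close> is the code of \<open>\<phi>\<close>.\<close>
      define w where "w j = (\<lambda>k::nat. v \<phi> j)" for j
      define i where "i = to_nat \<phi>"
      have w: "w \<in> UNIV \<rightarrow> carrier ?M"
        using v by (auto simp: w_def Pi_iff)
      have "eval ?Q (\<lambda>j. ?q (w j)) \<phi> = ?q \<one>\<^bsub>?M\<^esub>"
        using that w F.carrier_quotient by (auto simp: valid_in_def Q_one)
      then have "?q (eval ?M w \<phi>) = ?q \<one>\<^bsub>?M\<^esub>"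
        using term_eval_hom[OF M.sig_algebra_axioms F.hom_quotient w, of "trm_of_fm \<phi>"] by simp
      moreover have "eval ?M w \<phi> = (\<lambda>k. a i)"
        using term_eval_power[of A w "trm_of_fm \<phi>"] unprov
        by (auto simp: w_def i_def a_def fun_eq_iff)
      ultimately have "(\<lambda>k. a i) \<in> F"
        using F.fclass_eq_one[of "\<lambda>k. a i"] by simp
      \<comment> \<open>The inequality \<open>a i \<sqsubseteq> c k\<close> is available from
        \<open>k = i\<close> on. Multiplying by \<open>e\<close>, which lies in \<open>F0\<close>,
        makes the earlier coordinates \<open>\<zero>\<close>, so the product is below
        \<open>c\<close> everywhere and would put \<open>c\<close> into \<open>F\<close>.\<close>
      moreover define e where "e k = (if k < i then \<zero>\<^bsub>A\<^esub> else \<one>\<^bsub>A\<^esub>)" for k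
      have "e \<in> F0"
        by (auto simp: F0_def e_def intro!: exI[of _ i])
      ultimately have "(\<lambda>k. a i) \<otimes>\<^bsub>?M\<^esub> e \<in> F"
        using F(2) F.F_mult by blast
      moreover have "alg_le ?M ((\<lambda>k. a i) \<otimes>\<^bsub>?M\<^esub> e) c"
        unfolding M_le
      proof
        fix k
        show "alg_le A (((\<lambda>k. a i) \<otimes>\<^bsub>?M\<^esub> e) k) (c k)"
          using A.le_trans[OF A.mult_le2[of "a i" "\<zero>\<^bsub>A\<^esub>"] A.zero_le[OF c[of k]]] ac[of i k]
          by (simp add: e_def)
      qed
      ultimately show False
        using F.F_up cM F(3) by blast
    qed
    then have complQ: "complete_wrt L ?Q"
      using Q by (auto simp: complete_wrt_def L_algebra_def)
    have q_pow: "?q (x [^]\<^bsub>?M\<^esub> (m::nat)) = ?q x [^]\<^bsub>?Q\<^esub> m" if "x \<in> carrier ?M" for x m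
      by (induction m) (use that alg_homD(1,4)[OF F.hom_quotient] M.nat_pow_closed in simp_all)
    have qc: "?q c \<in> carrier ?Q"
      using cM F.carrier_quotient by blast

    \<comment> \<open>Irreducibility of a countable subalgebra\<close>
    obtain D :: "'b mtl_struct" and h where D: "L_algebra L D" "complete_wrt L D"
      and h: "h \<in> embedding D ?Q" and "?q c \<in> h ` carrier D"
      using countable_L_subalgebra[OF Q complQ qc] by metis
    then obtain d where d: "d \<in> carrier D" "h d = ?q c"
      by auto
    interpret D: mtl_algebra D
      using D(1) by (simp add: L_algebra_def)
    have h_one: "h x = ?q \<one>\<^bsub>?M\<^esub> \<longleftrightarrow> x = \<one>\<^bsub>D\<^esub>" if "x \<in> carrier D" for x
      using embedding_eq_iff[OF h that D.one_in] embedding_const(1)[OF h] Q_one by simp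
    have "subdirectly_irreducible D"
    proof (rule D.subdirectly_irreducible_if_monolith[OF d(1)])
      show "d \<noteq> \<one>\<^bsub>D\<^esub>"
        using h_one[OF d(1)] d(2) F.fclass_eq_one[OF cM] F(3) by simp
      fix x assume x: "x \<in> carrier D" "x \<noteq> \<one>\<^bsub>D\<^esub>"
      then have "h x \<in> carrier ?Q"
        using embedding_sig(1)[OF h] by simp
      then obtain y where y: "y \<in> carrier ?M" "h x = ?q y"
        using F.carrier_quotient by auto
      then have "y \<notin> F"
        using h_one[OF x(1)] x(2) F.fclass_eq_one[OF y(1)] by simp
      then obtain m :: nat where "M.fle F (y [^]\<^bsub>?M\<^esub> m) c"
        using max y(1) by blast
      \<comment> \<open>Being below \<open>c\<close> modulo \<open>F\<close> means that the residuum
        lies in \<open>F\<close>, so its class is \<open>\<one>\<close>. The resulting inequality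
        between the power and the class of \<open>c\<close> is then reflected by the embedding
        \<open>h\<close> into one in \<open>D\<close>.\<close>
      then have "?q (y [^]\<^bsub>?M\<^esub> m \<leadsto>\<^bsub>?M\<^esub> c) = \<one>\<^bsub>?Q\<^esub>"
        using y(1) cM by (simp add: Q_one F.fclass_eq_one F.fle_iff del: power_alg_simps)
      then have "?q (y [^]\<^bsub>?M\<^esub> m) \<leadsto>\<^bsub>?Q\<^esub> ?q c = \<one>\<^bsub>?Q\<^esub>"
        using alg_homD(5)[OF F.hom_quotient] y(1) cM M.nat_pow_closed by metis
      then have "alg_le ?Q (h x [^]\<^bsub>?Q\<^esub> m) (h d)"
        using Q.resid_eq_one qc y q_pow d(2) \<open>h x \<in> carrier ?Q\<close> Q.nat_pow_closed by metis
      then have "alg_le D (x [^]\<^bsub>D\<^esub> m) d"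
        using alg_le_embedding[OF h D.sig_algebra_axioms] x(1) d(1) embedding_pow[OF h D.mtl_algebra_axioms]
        by (metis D.nat_pow_closed)
      then show "\<exists>m::nat. alg_le D (x [^]\<^bsub>D\<^esub> m) d" ..
    qed
    then show ?thesis
      using suff D by blast
  qed
qed

theorem theorem3p5:
  fixes n :: nat and L :: "fm set"
  assumes "n \<ge> 1" and "contractive n L"
  shows "single_chain_complete TYPE('a::infinite) L \<longleftrightarrow>
         subdirect_single_chain_complete TYPE('b::infinite) L"
  using single_chain_complete_if_subdirect subdirect_if_single_chain_complete by blast

end
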